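(* Let $c \ge 2$ and let $\xi(n,c)=\left(\frac{n}{\lfloor c/2\rfloor}\right)^{\lfloor c/2\rfloor}$. There is a set-based symbolic algorithm that, given a parity game with $n$ vertices and priorities $\{0,\dots,c-1\}$, computes the winning sets $W_{\mathcal E}$ and $W_{\mathcal O}$ of the two players, using $O(c\cdot n\cdot \xi(n,c))$ symbolic one-step operations, $O(c\cdot n^2\cdot \xi(n,c))$ symbolic set operations, and storing only $O(n)$ many sets.
   Context: A game graph is $G=((V,E),(V_{\mathcal E},V_{\mathcal O}))$: a finite directed graph $(V,E)$ with $n=|V|$ in which every vertex has at least one outgoing edge, together with a partition of $V$ into vertices $V_{\mathcal E}$ of player $\mathcal E$ (even) and $V_{\mathcal O}$ of player $\mathcal O$ (odd). A parity game $(G,\alpha)$ additionally has a priority function $\alpha:V\to\{0,\dots,c-1\}$; $P_i=\{v\mid \alpha(v)=i\}$, and (as a standing convention) $P_i\neq\emptyset$ for all $0<i<c$. A play is an infinite path; the owner of the current vertex chooses the next edge. Player $\mathcal E$ wins a play if the highest priority occurring infinitely often is even, otherwise player $\mathcal O$ wins. The winning set $W_p$ of player $p$ is the set of start vertices from which $p$ has a strategy winning against all strategies of the opponent. A set-based symbolic algorithm accesses the game only via sets of vertices, using (i) basic set operations $\cup,\cap,\setminus,\subseteq,=$ (symbolic set operations) and (ii) symbolic one-step operations $\mathrm{Pre}(B)=\{v\mid \exists u\in B:(v,u)\in E\}$ and $\mathrm{CPre}_p(B)=\{v\in V_p\mid \mathrm{Out}(v)\cap B\neq\emptyset\}\cup\{v\in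 V_{\bar p}\mid \mathrm{Out}(v)\subseteq B\}$ for a player $p$ with opponent $\bar p$, where $\mathrm{Out}(v)$ is the set of successors of $v$. Its space is the maximum number of vertex sets it stores (each set counting as constant space). *)

theory Defs
  imports Complex_Main
begin

section \<open>Parity games\<close>

datatype player = Even | Odd

fun opponent :: "player \<Rightarrow> player" where
  "opponent Even = Odd"
| "opponent Odd = Even"

record 'v game =
  verts :: "'v set"
  edges :: "('v \<times> 'v) set"
  owned :: "player \<Rightarrow> 'v set"
  prio  :: "'v \<Rightarrow> nat"

definition game_graph :: "'v game \<Rightarrow> bool" where
  "game_graph G \<longleftrightarrow>
     finite (verts G) \<and> edges G \<subseteq> verts G \<times> verts G \<and>
     (\<forall>v\<in>verts G. \<exists>u. (v, u) \<in> edges G) \<and>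
     owned G Even \<union> owned G Odd = verts G \<and> owned G Even \<inter> owned G Odd = {}"

definition prio_class :: "'v game \<Rightarrow> nat \<Rightarrow> 'v set" where
  "prio_class G i = {v \<in> verts G. prio G v = i}"

definition parity_game :: "'v game \<Rightarrow> nat \<Rightarrow> bool" where
  "parity_game G c \<longleftrightarrow>
     game_graph G \<and> (\<forall>v\<in>verts G. prio G v < c) \<and>
     (\<forall>i. 0 < i \<and> i < c \<longrightarrow> prio_class G i \<noteq> {})"

text \<open>A strategy of a player maps each nonempty history ending in one of the player's vertices
  to a successor of that vertex; its values on other lists are irrelevant.\<close>

definition strategy :: "'v game \<Rightarrow> player \<Rightarrow> ('v list \<Rightarrow> 'v) \<Rightarrow> bool" where
  "strategy G p \<sigma> \<longleftrightarrow>
     (\<forall>h. h \<noteq> [] \<and> last h \<in> owned G p \<longrightarrow> (last h, \<sigma> h) \<in> edges G)"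

primrec history ::
  "'v game \<Rightarrow> player \<Rightarrow> ('v list \<Rightarrow> 'v) \<Rightarrow> ('v list \<Rightarrow> 'v) \<Rightarrow> 'v \<Rightarrow> nat \<Rightarrow> 'v list" where
  "history G p \<sigma> \<tau> v 0 = [v]"
| "history G p \<sigma> \<tau> v (Suc k) =
     (let h = history G p \<sigma> \<tau> v k
      in h @ [if last h \<in> owned G p then \<sigma> h else \<tau> h])"

text \<open>The play from \<open>v\<close> in which player \<open>p\<close> follows \<open>\<sigma>\<close> and the opponent follows \<open>\<tau>\<close>.\<close>

definition outcome ::
  "'v game \<Rightarrow> player \<Rightarrow> ('v list \<Rightarrow> 'v) \<Rightarrow> ('v list \<Rightarrow> 'v) \<Rightarrow> 'v \<Rightarrow> nat \<Rightarrow> 'v" where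
  "outcome G p \<sigma> \<tau> v k = last (history G p \<sigma> \<tau> v k)"

definition top_priority :: "'v game \<Rightarrow> (nat \<Rightarrow> 'v) \<Rightarrow> nat" where
  "top_priority G \<pi> = Max {i. infinite {k. prio G (\<pi> k) = i}}"

fun wins :: "'v game \<Rightarrow> player \<Rightarrow> (nat \<Rightarrow> 'v) \<Rightarrow> bool" where
  "wins G Even \<pi> \<longleftrightarrow> even (top_priority G \<pi>)"
| "wins G Odd \<pi> \<longleftrightarrow> odd (top_priority G \<pi>)"

definition winning_set :: "'v game \<Rightarrow> player \<Rightarrow> 'v set" where
  "winning_set G p =
     {v \<in> verts G. \<exists>\<sigma>. strategy G p \<sigma> \<and>
        (\<forall>\<tau>. strategy G (opponent p) \<tau> \<longrightarrow> wins G p (outcome G p \<sigma> \<tau> v))}"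

section \<open>Symbolic one-step operations\<close>

definition out :: "'v game \<Rightarrow> 'v \<Rightarrow> 'v set" where
  "out G v = {u. (v, u) \<in> edges G}"

definition pre :: "'v game \<Rightarrow> 'v set \<Rightarrow> 'v set" where
  "pre G B = {v. \<exists>u\<in>B. (v, u) \<in> edges G}"

definition cpre :: "'v game \<Rightarrow> player \<Rightarrow> 'v set \<Rightarrow> 'v set" where
  "cpre G p B = {v \<in> owned G p. out G v \<inter> B \<noteq> {}} \<union> {v \<in> owned G (opponent p). out G v \<subseteq> B}"

section \<open>Set-based symbolic algorithms\<close>

text \<open>
  An algorithm is a program of a while language that does not mention the vertex type.  The store
  has two disjoint parts: arrays of natural numbers, which carry the control data and may be
  manipulated by arithmetic free of charge, and arrays of set registers, each holding one set of
  vertices.  Set registers can be read and written only by the basic set operations and the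
  symbolic one-step operations, and information flows from sets to numbers only through the tests
  \<open>\<subseteq>\<close> and \<open>=\<close>.  In particular neither cardinalities nor individual vertices are accessible.
\<close>

type_synonym vname = string

datatype nexp =
    Num nat
  | Cell vname nexp
  | Plus nexp nexp
  | Minus nexp nexp
  | Times nexp nexp

datatype bexp =
    Less nexp nexp
  | Eq nexp nexp
  | Neg bexp
  | Conj bexp bexp

datatype reg = Reg vname nexp

datatype set_fun = SUnion | SInter | SDiff

datatype set_test = SSubset | SEqual

datatype com =
    Skip
  | Assign vname nexp nexp
  | SetOp reg set_fun reg reg
  | SetTest vname nexp set_test reg reg
  | PreOp reg reg
  | CPreOp player reg reg
  | Seq com com
  | Cond bexp com com
  | While bexp com

type_synonym nstore = "vname \<Rightarrow> nat \<Rightarrow> nat"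

fun nval :: "nexp \<Rightarrow> nstore \<Rightarrow> nat" where
  "nval (Num k) m = k"
| "nval (Cell x e) m = m x (nval e m)"
| "nval (Plus e f) m = nval e m + nval f m"
| "nval (Minus e f) m = nval e m - nval f m"
| "nval (Times e f) m = nval e m * nval f m"

fun bval :: "bexp \<Rightarrow> nstore \<Rightarrow> bool" where
  "bval (Less e f) m \<longleftrightarrow> nval e m < nval f m"
| "bval (Eq e f) m \<longleftrightarrow> nval e m = nval f m"
| "bval (Neg b) m \<longleftrightarrow> \<not> bval b m"
| "bval (Conj b d) m \<longleftrightarrow> bval b m \<and> bval d m"

fun addr :: "reg \<Rightarrow> nstore \<Rightarrow> vname \<times> nat" where
  "addr (Reg x e) m = (x, nval e m)"

fun set_fun_val :: "set_fun \<Rightarrow> 'v set \<Rightarrow> 'v set \<Rightarrow> 'v set" where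
  "set_fun_val SUnion A B = A \<union> B"
| "set_fun_val SInter A B = A \<inter> B"
| "set_fun_val SDiff A B = A - B"

fun set_test_val :: "set_test \<Rightarrow> 'v set \<Rightarrow> 'v set \<Rightarrow> bool" where
  "set_test_val SSubset A B \<longleftrightarrow> A \<subseteq> B"
| "set_test_val SEqual A B \<longleftrightarrow> A = B"

text \<open>Besides the store, a state records the number of symbolic one-step operations and of
  symbolic set operations executed so far, and the set registers used so far.\<close>

record 'v state =
  nums      :: nstore
  regs      :: "vname \<times> nat \<Rightarrow> 'v set"
  one_steps :: nat
  set_ops   :: nat
  used      :: "(vname \<times> nat) set"

definition assign_num :: "vname \<Rightarrow> nat \<Rightarrow> nat \<Rightarrow> 'v state \<Rightarrow> 'v state" where
  "assign_num x i k s = s\<lparr>nums := (nums s)(x := (nums s x)(i := k))\<rparr>"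

definition assign_reg :: "vname \<times> nat \<Rightarrow> 'v set \<Rightarrow> 'v state \<Rightarrow> 'v state" where
  "assign_reg a B s = s\<lparr>regs := (regs s)(a := B)\<rparr>"

definition count_one_step :: "(vname \<times> nat) set \<Rightarrow> 'v state \<Rightarrow> 'v state" where
  "count_one_step A s = s\<lparr>one_steps := one_steps s + 1, used := used s \<union> A\<rparr>"

definition count_set_op :: "(vname \<times> nat) set \<Rightarrow> 'v state \<Rightarrow> 'v state" where
  "count_set_op A s = s\<lparr>set_ops := set_ops s + 1, used := used s \<union> A\<rparr>"

inductive exec :: "'v game \<Rightarrow> com \<Rightarrow> 'v state \<Rightarrow> 'v state \<Rightarrow> bool" for G where
  Skip: "exec G Skip s s"
| Assign: "exec G (Assign x e f) s (assign_num x (nval e (nums s)) (nval f (nums s)) s)"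
| SetOp:
    "\<lbrakk>a = addr r (nums s); a1 = addr r1 (nums s); a2 = addr r2 (nums s)\<rbrakk> \<Longrightarrow>
     exec G (SetOp r g r1 r2) s
       (count_set_op {a, a1, a2} (assign_reg a (set_fun_val g (regs s a1) (regs s a2)) s))"
| SetTest:
    "\<lbrakk>a1 = addr r1 (nums s); a2 = addr r2 (nums s)\<rbrakk> \<Longrightarrow>
     exec G (SetTest x e g r1 r2) s
       (count_set_op {a1, a2}
         (assign_num x (nval e (nums s)) (of_bool (set_test_val g (regs s a1) (regs s a2))) s))"
| PreOp:
    "\<lbrakk>a = addr r (nums s); a1 = addr r1 (nums s)\<rbrakk> \<Longrightarrow>
     exec G (PreOp r r1) s (count_one_step {a, a1} (assign_reg a (pre G (regs s a1)) s))"
| CPreOp: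
    "\<lbrakk>a = addr r (nums s); a1 = addr r1 (nums s)\<rbrakk> \<Longrightarrow>
     exec G (CPreOp p r r1) s (count_one_step {a, a1} (assign_reg a (cpre G p (regs s a1)) s))"
| Seq: "\<lbrakk>exec G c s s'; exec G d s' s''\<rbrakk> \<Longrightarrow> exec G (Seq c d) s s''"
| CondTrue: "\<lbrakk>bval b (nums s); exec G c s t\<rbrakk> \<Longrightarrow> exec G (Cond b c d) s t"
| CondFalse: "\<lbrakk>\<not> bval b (nums s); exec G d s t\<rbrakk> \<Longrightarrow> exec G (Cond b c d) s t"
| WhileFalse: "\<not> bval b (nums s) \<Longrightarrow> exec G (While b c) s s"
| WhileTrue:
    "\<lbrakk>bval b (nums s); exec G c s s'; exec G (While b c) s' s''\<rbrakk> \<Longrightarrow> exec G (While b c) s s''"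

text \<open>The input consists of the numbers \<open>n = |V|\<close> and \<open>c\<close> and of the vertex sets of the two players
  and of the priorities; all other number cells are \<open>0\<close> and all other set registers are empty.\<close>

definition input_regs :: "nat \<Rightarrow> (vname \<times> nat) set" where
  "input_regs c = {(''VE'', 0), (''VO'', 0)} \<union> {(''P'', i) | i. i < c}"

definition initial_state :: "'v game \<Rightarrow> nat \<Rightarrow> 'v state" where
  "initial_state G c =
     \<lparr>nums = (\<lambda>x i. if x = ''n'' \<and> i = 0 then card (verts G)
                    else if x = ''c'' \<and> i = 0 then c else 0),
      regs = (\<lambda>(x, i). if x = ''VE'' \<and> i = 0 then owned G Even
                       else if x = ''VO'' \<and> i = 0 then owned G Odd
                       else if x = ''P'' \<and> i < c then prio_class G i else {}),
      one_steps = 0, set_ops = 0, used = input_regs c\<rparr>"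

definition xi :: "nat \<Rightarrow> nat \<Rightarrow> real" where
  "xi n c = (real n / real (c div 2)) ^ (c div 2)"

end

theory Submission
  imports Defs
begin

text \<open>Only set operations are charged, arithmetic on numbers is free. Hence it suffices to extract
  the game up to bisimulation and to solve the quotient numerically. Partition refinement with
  \<open>Pre\<close>, started from the classes of equal owner and priority, needs at most \<open>n\<close> classes, \<open>O(n\<^sup>2)\<close>
  one-step operations and \<open>O(n\<^sup>3)\<close> set operations, and it reveals the edges of the quotient.
  The least progress measure of the quotient is then computed by lifting, and the winning sets are
  unions of classes. As all positive priorities occur, \<open>n \<ge> c - 1\<close>, and Bernoulli's inequality
  gives \<open>\<xi>(n,c) \<ge> n / 2\<close>, so these costs are within the claimed bounds.

  That lifting finds the winning sets rests on the alternating fixpoint formula: the stages of its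
  least fixpoints form progress measures for both players on complementary sets, with digits
  at most \<open>n\<close>.\<close>

section \<open>Progress measures\<close>

text \<open>Determinacy is not presupposed. A progress measure for each player, on complementary
  sets, shows that the two winning sets cover the graph; disjointness comes from playing two winning
  strategies against each other. The measure of Even also bounds the computed ranks from above, so
  lifting cannot declare a vertex of its domain lost; and once lifting has stopped, the ranks below
  the top form a progress measure themselves. The program cannot name vertices, only classes, so the
  numerical phase needs a partition on which the game looks the same from every member of a class.
  Stability under \<open>pre\<close> supplies this, and one rank per class suffices. The top rank is
  \<open>(n + 1) ^ c\<close>, and the length of lifting is bounded only through it, but lifting
  touches no set register. The base \<open>n + 1\<close> comes from the least fixpoints, whose
  iterations close after at most \<open>n\<close> stages. The inequality
  \<open>c \<le> n + 1\<close> serves two more purposes: it absorbs the \<open>4 * c\<close> set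
  operations that read the priorities, and the \<open>c\<close> input registers.\<close>

fun favours :: "player \<Rightarrow> nat \<Rightarrow> bool" where
  "favours Even i \<longleftrightarrow> even i"
| "favours Odd i \<longleftrightarrow> odd i"

lemma favours_opponent [simp]: "favours (opponent p) i \<longleftrightarrow> \<not> favours p i"
  by (cases p) auto

lemma opponent_opponent [simp]: "opponent (opponent p) = p"
  by (cases p) auto

lemma wins_iff_favours: "wins G p \<pi> \<longleftrightarrow> favours p (top_priority G \<pi>)"
  by (cases p) auto

lemma cpre_mono:
  assumes "A \<subseteq> B"
  shows "cpre G p A \<subseteq> cpre G p B"
  using assms unfolding cpre_def by blast

lemma owned_player_Un:
  assumes "game_graph G"
  shows "owned G p \<union> owned G (opponent p) = verts G" "owned G p \<inter> owned G (opponent p) = {}"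
  using assms unfolding game_graph_def by (cases p; auto)+

lemma out_subset_verts:
  assumes "game_graph G"
  shows "out G v \<subseteq> verts G"
  using assms unfolding game_graph_def out_def by auto

lemma cpre_subset_verts:
  assumes "game_graph G"
  shows "cpre G p A \<subseteq> verts G"
  using owned_player_Un[OF assms, of p] unfolding cpre_def by auto

lemma cpre_dual:
  assumes "game_graph G" "A \<subseteq> verts G"
  shows "verts G - cpre G p A = cpre G (opponent p) (verts G - A)"
proof (rule set_eqI)
  fix v
  note o = owned_player_Un[OF assms(1), of p] out_subset_verts[OF assms(1), of v]
  show "v \<in> verts G - cpre G p A \<longleftrightarrow> v \<in> cpre G (opponent p) (verts G - A)"
  proof (cases "v \<in> owned G p")
    case True
    then have "v \<in> verts G" "v \<notin> owned G (opponent p)" using o by auto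
    then show ?thesis
      using True o(3) unfolding cpre_def by auto
  next
    case False
    then have "v \<in> verts G \<longleftrightarrow> v \<in> owned G (opponent p)" using o by auto
    then show ?thesis
      using False o(3) unfolding cpre_def by auto
  qed
qed

text \<open>A rank is a number read in base \<open>b\<close>; the quotient by \<open>b ^ i\<close> keeps the digits of the
  priorities \<open>\<ge> i\<close>.\<close>

definition rank_ok :: "'v game \<Rightarrow> player \<Rightarrow> nat \<Rightarrow> ('v \<Rightarrow> nat) \<Rightarrow> 'v \<Rightarrow> 'v \<Rightarrow> bool" where
  "rank_ok G p b \<rho> v u \<longleftrightarrow>
     (if favours p (prio G v) then \<rho> u div b ^ prio G v \<le> \<rho> v div b ^ prio G v
      else \<rho> u div b ^ prio G v < \<rho> v div b ^ prio G v)"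

text \<open>The domain \<open>Y\<close> is explicit instead of a top value for lost vertices.
  Through \<open>cpre\<close>, one condition covers some good successor for \<open>p\<close> and
  only good successors for the opponent, and keeps the play in \<open>Y\<close>.\<close>

definition progress_measure :: "'v game \<Rightarrow> player \<Rightarrow> nat \<Rightarrow> ('v \<Rightarrow> nat) \<Rightarrow> 'v set \<Rightarrow> bool" where
  "progress_measure G p b \<rho> Y \<longleftrightarrow> (\<forall>v\<in>Y. v \<in> cpre G p {u \<in> Y. rank_ok G p b \<rho> v u})"

section \<open>Plays, their top priority, and disjointness of the winning sets\<close>

lemma history_nonempty [simp]: "history G p \<sigma> \<tau> v k \<noteq> []"
  by (cases k) (auto simp: Let_def)

lemma outcome_0 [simp]: "outcome G p \<sigma> \<tau> v 0 = v"
  by (simp add: outcome_def)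

lemma outcome_Suc:
  "outcome G p \<sigma> \<tau> v (Suc k) =
     (let h = history G p \<sigma> \<tau> v k
      in if outcome G p \<sigma> \<tau> v k \<in> owned G p then \<sigma> h else \<tau> h)"
  by (simp add: outcome_def Let_def)

lemma outcome_edge:
  assumes "game_graph G" "v \<in> verts G" "strategy G p \<sigma>" "strategy G (opponent p) \<tau>"
  shows "(outcome G p \<sigma> \<tau> v k, outcome G p \<sigma> \<tau> v (Suc k)) \<in> edges G"
proof -
  have step: "(outcome G p \<sigma> \<tau> v k, outcome G p \<sigma> \<tau> v (Suc k)) \<in> edges G"
    if "outcome G p \<sigma> \<tau> v k \<in> verts G" for k
  proof -
    let ?h = "history G p \<sigma> \<tau> v k"
    have h: "last ?h = outcome G p \<sigma> \<tau> v k" "?h \<noteq> []"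
      by (simp_all add: outcome_def)
    show ?thesis
    proof (cases "last ?h \<in> owned G p")
      case True
      then have "(last ?h, \<sigma> ?h) \<in> edges G"
        using assms(3) h(2) unfolding strategy_def by blast
      then show ?thesis using True h(1) by (simp add: outcome_Suc Let_def)
    next
      case False
      then have "last ?h \<in> owned G (opponent p)"
        using that owned_player_Un[OF assms(1), of p] h(1) by auto
      then have "(last ?h, \<tau> ?h) \<in> edges G"
        using assms(4) h(2) unfolding strategy_def by blast
      then show ?thesis using False h(1) by (simp add: outcome_Suc Let_def)
    qed
  qed
  have "outcome G p \<sigma> \<tau> v k \<in> verts G"
  proof (induction k)
    case (Suc k)
    then show ?case
      using step[of k] assms(1) unfolding game_graph_def by blast
  qed (simp add: assms(2))
  then show ?thesis by (rule step)
qed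

lemma outcome_in_verts:
  assumes "game_graph G" "v \<in> verts G" "strategy G p \<sigma>" "strategy G (opponent p) \<tau>"
  shows "outcome G p \<sigma> \<tau> v k \<in> verts G"
  using outcome_edge[OF assms, of k] assms(1) unfolding game_graph_def by blast

text \<open>Each side hands vertices not owned by its first player to the second strategy. The two
  readings agree because the play stays in \<open>verts G\<close>, where ownership is a
  partition.\<close>

lemma history_opponent:
  assumes "game_graph G" "v \<in> verts G" "strategy G p \<sigma>" "strategy G (opponent p) \<tau>"
  shows "history G (opponent p) \<tau> \<sigma> v k = history G p \<sigma> \<tau> v k"
proof (induction k)
  case (Suc k)
  have "outcome G p \<sigma> \<tau> v k \<in> verts G"
    by (rule outcome_in_verts[OF assms])
  then show ?case
    using Suc owned_player_Un[OF assms(1), of p] by (auto simp: Let_def outcome_def)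
qed simp

lemma winning_sets_disjoint:
  assumes "game_graph G"
  shows "winning_set G Even \<inter> winning_set G Odd = {}"
proof (rule ccontr)
  assume "\<not> ?thesis"
  then obtain v \<sigma> \<tau> where v: "v \<in> verts G" and \<sigma>: "strategy G Even \<sigma>"
    and w: "\<And>\<tau>. strategy G Odd \<tau> \<Longrightarrow> wins G Even (outcome G Even \<sigma> \<tau> v)"
    and \<tau>: "strategy G Odd \<tau>"
    and l: "\<And>\<sigma>. strategy G Even \<sigma> \<Longrightarrow> wins G Odd (outcome G Odd \<tau> \<sigma> v)"
    unfolding winning_set_def by auto
  have "outcome G Odd \<tau> \<sigma> v = outcome G Even \<sigma> \<tau> v"
    using history_opponent[OF assms v, of Even \<sigma> \<tau>] \<sigma> \<tau> by (simp add: outcome_def fun_eq_iff)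
  then show False
    using w[OF \<tau>] l[OF \<sigma>] by simp
qed

text \<open>By pigeonhole some priority below \<open>c\<close> recurs, so the \<open>Max\<close> in
  \<open>top_priority\<close> ranges over a finite nonempty set and is meaningful.\<close>

lemma top_priority_attained:
  assumes "\<And>k. prio G (\<pi> k) < c"
  shows "infinite {k. prio G (\<pi> k) = top_priority G \<pi>}"
    and "finite {k. top_priority G \<pi> < prio G (\<pi> k)}"
proof -
  define I where "I = {i. infinite {k. prio G (\<pi> k) = i}}"
  have "I \<subseteq> {..<c}"
  proof
    fix i assume "i \<in> I"
    then obtain k where "prio G (\<pi> k) = i"
      unfolding I_def using not_finite_existsD by blast
    then show "i \<in> {..<c}" using assms by auto
  qed
  then have fin: "finite I"
    using finite_subset by blast
  have "\<exists>i. infinite {k. prio G (\<pi> k) = i}"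
  proof (rule ccontr)
    assume "\<not> ?thesis"
    then have "finite (\<Union>i<c. {k. prio G (\<pi> k) = i})"
      by auto
    moreover have "(\<Union>i<c. {k. prio G (\<pi> k) = i}) = UNIV"
      using assms by auto
    ultimately show False by simp
  qed
  then have "I \<noteq> {}" unfolding I_def by auto
  then have "top_priority G \<pi> \<in> I"
    using Max_in[OF fin] unfolding I_def top_priority_def by simp
  then show "infinite {k. prio G (\<pi> k) = top_priority G \<pi>}"
    unfolding I_def by simp
  have "finite {k. prio G (\<pi> k) = i}" if "top_priority G \<pi> < i" for i
  proof (rule ccontr)
    assume "infinite {k. prio G (\<pi> k) = i}"
    then have "i \<le> top_priority G \<pi>"
      using Max_ge[OF fin] unfolding I_def top_priority_def by simp
    then show False using that by simp
  qed
  then have "finite (\<Union>i\<in>{top_priority G \<pi><..<c}. {k. prio G (\<pi> k) = i})"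
    by auto
  moreover have "{k. top_priority G \<pi> < prio G (\<pi> k)} \<subseteq>
      (\<Union>i\<in>{top_priority G \<pi><..<c}. {k. prio G (\<pi> k) = i})"
    using assms by auto
  ultimately show "finite {k. top_priority G \<pi> < prio G (\<pi> k)}"
    using finite_subset by blast
qed

text \<open>Past \<open>m\<close> every strict drop in \<open>A\<close> is permanent, so
  \<open>f m\<close> would have to exceed every number \<open>j\<close> of drops.\<close>

lemma no_infinite_descent_nat:
  fixes f :: "nat \<Rightarrow> nat"
  assumes "\<And>k. k \<ge> m \<Longrightarrow> f (Suc k) \<le> f k"
    and "infinite A" "\<And>k. k \<in> A \<Longrightarrow> k \<ge> m \<Longrightarrow> f (Suc k) < f k"
  shows False
proof -
  have mono: "f l \<le> f k" if "m \<le> k" "k \<le> l" for k l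
    using that(2)
  proof (induction l rule: dec_induct)
    case (step l)
    then show ?case
      using assms(1)[of l] that(1) by linarith
  qed simp
  have "\<exists>k\<ge>m. f k + j \<le> f m" for j
  proof (induction j)
    case 0
    then show ?case by auto
  next
    case (Suc j)
    then obtain k where k: "k \<ge> m" "f k + j \<le> f m" by auto
    obtain l where l: "l \<ge> k" "l \<in> A"
      using assms(2) unfolding finite_nat_set_iff_bounded by (meson not_less)
    have "f (Suc l) < f l" "f l \<le> f k"
      using assms(3) l k mono by auto
    then show ?case using k l by (intro exI[of _ "Suc l"]) auto
  qed
  from this[of "Suc (f m)"] show False by auto
qed

text \<open>The player moves to a successor respecting the measure. If the top priority \<open>i\<close> of the play
  were unfavourable, the ranks divided by \<open>b ^ i\<close> would eventually never increase, yet decrease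
  infinitely often.\<close>

lemma progress_measure_winning:
  assumes G: "game_graph G" and c: "\<And>v. v \<in> verts G \<Longrightarrow> prio G v < c"
    and Y: "Y \<subseteq> verts G" and pm: "progress_measure G p b \<rho> Y" and b: "b > 0"
  shows "Y \<subseteq> winning_set G p"
proof
  fix v assume v: "v \<in> Y"
  \<comment> \<open>A strategy must move legally from all vertices of \<open>p\<close>, also outside
    \<open>Y\<close>, where any edge serves.\<close>
  have "\<exists>u. (w, u) \<in> edges G \<and> (w \<in> Y \<longrightarrow> u \<in> Y \<and> rank_ok G p b \<rho> w u)"
    if "w \<in> owned G p" for w
  proof (cases "w \<in> Y")
    case True
    then have "w \<in> cpre G p {u \<in> Y. rank_ok G p b \<rho> w u}"
      using pm unfolding progress_measure_def by blast
    then show ?thesis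
      using that owned_player_Un[OF G, of p] unfolding cpre_def out_def by auto
  next
    case False
    then show ?thesis
      using G that owned_player_Un[OF G, of p] unfolding game_graph_def by blast
  qed
  then obtain g where g: "\<And>w. w \<in> owned G p \<Longrightarrow> (w, g w) \<in> edges G"
      "\<And>w. w \<in> owned G p \<Longrightarrow> w \<in> Y \<Longrightarrow> g w \<in> Y \<and> rank_ok G p b \<rho> w (g w)"
    by metis
  define \<sigma> where "\<sigma> h = g (last h)" for h :: "'a list"
  have \<sigma>: "strategy G p \<sigma>"
    unfolding strategy_def \<sigma>_def using g by auto
  have "wins G p (outcome G p \<sigma> \<tau> v)" if \<tau>: "strategy G (opponent p) \<tau>" for \<tau>
  proof -
    define \<pi> where "\<pi> = outcome G p \<sigma> \<tau> v"
    have vV: "v \<in> verts G" using v Y by auto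
    have edge: "(\<pi> k, \<pi> (Suc k)) \<in> edges G" for k
      unfolding \<pi>_def by (rule outcome_edge[OF G vV \<sigma> \<tau>])
    have step: "\<pi> (Suc k) \<in> Y \<and> rank_ok G p b \<rho> (\<pi> k) (\<pi> (Suc k))" if "\<pi> k \<in> Y" for k
    proof (cases "\<pi> k \<in> owned G p")
      case True
      then have "\<pi> (Suc k) = g (\<pi> k)"
        unfolding \<pi>_def outcome_Suc Let_def \<sigma>_def by (simp add: outcome_def)
      then show ?thesis using g(2)[OF True that] by simp
    next
      case False
      then have "out G (\<pi> k) \<subseteq> {u \<in> Y. rank_ok G p b \<rho> (\<pi> k) u}"
        using pm that unfolding progress_measure_def cpre_def by blast
      then show ?thesis using edge[of k] unfolding out_def by auto
    qed
    have inY: "\<pi> k \<in> Y" for k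
      by (induction k) (use v step in \<open>auto simp: \<pi>_def\<close>)
    have ok: "rank_ok G p b \<rho> (\<pi> k) (\<pi> (Suc k))" for k
      using step inY by blast
    have prio: "prio G (\<pi> k) < c" for k
      using inY Y c by blast
    let ?i = "top_priority G \<pi>"
    have "favours p ?i"
    proof (rule ccontr)
      assume unfav: "\<not> favours p ?i"
      obtain m where m: "\<And>k. k \<ge> m \<Longrightarrow> prio G (\<pi> k) \<le> ?i"
        using top_priority_attained(2)[of G \<pi>, OF prio]
        unfolding finite_nat_set_iff_bounded by (auto simp: not_less[symmetric])
      define f where "f k = \<rho> (\<pi> k) div b ^ ?i" for k
      have "f (Suc k) \<le> f k" if "k \<ge> m" for k
      proof -
        let ?j = "prio G (\<pi> k)"
        \<comment> \<open>The quotient by \<open>b ^ ?i\<close> factors through the one by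
          \<open>b ^ ?j\<close>, so the weak inequality at \<open>?j\<close> passes to
          \<open>?i\<close>.\<close>
        have "b ^ ?i = b ^ ?j * b ^ (?i - ?j)"
          using m[OF that] by (simp add: power_add[symmetric])
        moreover have "\<rho> (\<pi> (Suc k)) div b ^ ?j \<le> \<rho> (\<pi> k) div b ^ ?j"
          using ok[of k] unfolding rank_ok_def by (auto split: if_splits)
        ultimately show ?thesis
          unfolding f_def by (simp add: div_mult2_eq div_le_mono)
      qed
      moreover have "f (Suc k) < f k" if "k \<in> {k. prio G (\<pi> k) = ?i}" for k
        using ok[of k] that unfav unfolding rank_ok_def f_def by auto
      ultimately show False
        using no_infinite_descent_nat[of m f, OF _ top_priority_attained(1)[of G \<pi>, OF prio]] by blast
    qed
    then show ?thesis
      unfolding wins_iff_favours \<pi>_def .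
  qed
  then show "v \<in> winning_set G p"
    using \<sigma> v Y unfolding winning_set_def by auto
qed

section \<open>Existence of small progress measures\<close>

text \<open>The iterates from the empty set grow strictly until they are stationary, and inside
  \<open>S\<close> they can grow at most \<open>card S\<close> times. This bounds the digits of the
  ranks.\<close>

lemma lfp_eq_funpow_card:
  fixes f :: "'a set \<Rightarrow> 'a set"
  assumes "mono f" "\<And>A. f A \<subseteq> S" "finite S"
  shows "lfp f = (f ^^ card S) {}"
proof -
  let ?Y = "\<lambda>i. (f ^^ i) {}"
  have sub: "?Y i \<subseteq> S" for i
    using assms(2) by (cases i) auto
  have mono: "mono ?Y"
    using assms(1) unfolding mono_iff_le_Suc
    by (metis funpow_decreasing bot_set_def le_SucI order_refl)
  have "finite (range ?Y)"
    by (rule finite_subset[of _ "Pow S"]) (use sub assms(3) in auto)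
  then have "?Y (card S) = (\<Union>i. ?Y i)"
    by (intro finite_mono_strict_prefix_implies_finite_fixpoint sub assms(3)
        finite_mono_remains_stable_implies_strict_prefix mono) auto
  then have "?Y (Suc (card S)) \<subseteq> ?Y (card S)"
    by blast
  then have "lfp f \<subseteq> ?Y (card S)"
    by (intro lfp_lowerbound) simp
  moreover have "?Y i \<subseteq> lfp f" for i
  proof (induction i)
    case (Suc i)
    then have "f (?Y i) \<subseteq> f (lfp f)" by (rule monoD[OF assms(1)])
    then show ?case using lfp_unfold[OF assms(1)] by simp
  qed simp
  ultimately show ?thesis by blast
qed

text \<open>Complements are taken relative to \<open>S\<close>, since the vertex type may be larger.
  The complement of \<open>lfp g\<close> is a post-fixpoint of \<open>f\<close>, and the complement
  of \<open>gfp f\<close> is a fixpoint of \<open>g\<close>; Knaster-Tarski gives one inclusion from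
  each.\<close>

lemma gfp_dual:
  fixes f g :: "'a set \<Rightarrow> 'a set"
  assumes f: "mono f" "\<And>A. f A \<subseteq> S" and g: "mono g" "\<And>A. g A \<subseteq> S"
    and dual: "\<And>A. A \<subseteq> S \<Longrightarrow> g A = S - f (S - A)"
  shows "S - gfp f = lfp g"
proof
  have L: "lfp g \<subseteq> S" "gfp f \<subseteq> S"
    using lfp_unfold[OF g(1)] gfp_unfold[OF f(1)] f g by blast+
  have "lfp g = S - f (S - lfp g)"
    using lfp_unfold[OF g(1)] dual[OF L(1)] by simp
  then have "S - lfp g \<subseteq> f (S - lfp g)"
    using f(2) by blast
  then have "S - lfp g \<subseteq> gfp f"
    by (rule gfp_upperbound)
  then show "S - gfp f \<subseteq> lfp g" by blast
  have "S - (S - gfp f) = gfp f"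
    using L by blast
  then have "g (S - gfp f) = S - gfp f"
    using dual[of "S - gfp f"] gfp_unfold[OF f(1)] by simp
  then show "lfp g \<subseteq> S - gfp f"
    by (intro lfp_lowerbound) simp
qed

text \<open>The alternating fixpoint formula for the winning set of \<open>p\<close>, restricted to the priorities
  below \<open>d\<close>; a vertex of priority \<open>i \<ge> d\<close> must be left into \<open>X i\<close>.\<close>

primrec nested :: "'v game \<Rightarrow> player \<Rightarrow> nat \<Rightarrow> (nat \<Rightarrow> 'v set) \<Rightarrow> 'v set" where
  "nested G p 0 = (\<lambda>X. {v. v \<in> cpre G p (X (prio G v))})"
| "nested G p (Suc d) =
     (\<lambda>X. if favours p d then gfp (\<lambda>Y. nested G p d (X(d := Y)))
          else lfp (\<lambda>Y. nested G p d (X(d := Y))))"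

lemma nested_mono: "mono (nested G p d)"
proof (induction d)
  case 0
  then show ?case
    using cpre_mono by (intro monoI) (fastforce simp: le_fun_def)
next
  case (Suc d)
  show ?case
  proof (rule monoI)
    fix X Z :: "nat \<Rightarrow> 'a set" assume "X \<le> Z"
    then have "nested G p d (X(d := Y)) \<subseteq> nested G p d (Z(d := Y))" for Y
      by (intro monoD[OF Suc]) (auto simp: le_fun_def)
    then show "nested G p (Suc d) X \<le> nested G p (Suc d) Z"
      by (cases "favours p d") (simp_all add: lfp_mono gfp_mono)
  qed
qed

lemma nested_update_mono: "mono (\<lambda>Y. nested G p d (X(d := Y)))"
  by (intro monoI monoD[OF nested_mono]) (auto simp: le_fun_def)

lemma nested_subset_verts:
  assumes "game_graph G"
  shows "nested G p d X \<subseteq> verts G"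
proof (induction d arbitrary: X)
  case 0
  then show ?case using cpre_subset_verts[OF assms] by auto
next
  case (Suc d)
  note mono = nested_update_mono[of G p d X]
  show ?case
  proof (cases "favours p d")
    case True
    then show ?thesis
      using Suc by (simp, subst gfp_unfold[OF mono])
  next
    case False
    then show ?thesis
      using Suc by (simp, subst lfp_unfold[OF mono])
  qed
qed

text \<open>Complementation swaps the players in \<open>cpre\<close>; as it also flips
  \<open>favours\<close>, it exchanges greatest and least fixpoints at every level. This puts
  determinacy into the formula.\<close>

lemma nested_dual:
  assumes G: "game_graph G"
  shows "(\<And>i. X i \<subseteq> verts G) \<Longrightarrow>
    verts G - nested G p d X = nested G (opponent p) d (\<lambda>i. verts G - X i)"
proof (induction d arbitrary: X)
  case 0
  then show ?case
  proof -
    have "v \<in> verts G - cpre G p (X (prio G v)) \<longleftrightarrow>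
        v \<in> cpre G (opponent p) (verts G - X (prio G v))" for v
      using cpre_dual[OF G 0] by simp
    then show ?thesis by auto
  qed
next
  case (Suc d)
  let ?S = "verts G"
  let ?f = "\<lambda>Y. nested G p d (X(d := Y))"
  let ?g = "\<lambda>Y. nested G (opponent p) d ((\<lambda>i. ?S - X i)(d := Y))"
  have dual: "?g Y = ?S - ?f (?S - Y)" if "Y \<subseteq> ?S" for Y
  proof -
    have "?S - ?f (?S - Y) = nested G (opponent p) d (\<lambda>i. ?S - (X(d := ?S - Y)) i)"
      using Suc.prems by (intro Suc.IH) auto
    also have "(\<lambda>i. ?S - (X(d := ?S - Y)) i) = (\<lambda>i. ?S - X i)(d := Y)"
      using that by (auto simp: fun_eq_iff)
    finally show ?thesis by (rule sym)
  qed
  have dual': "?f Y = ?S - ?g (?S - Y)" if "Y \<subseteq> ?S" for Y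
  proof -
    have "?S - (?S - Y) = Y" using that by blast
    then show ?thesis
      using dual[of "?S - Y"] nested_subset_verts[OF G, of p d "X(d := Y)"] by auto
  qed
  note sub = nested_subset_verts[OF G]
  show ?case
  proof (cases "favours p d")
    case True
    have "?S - gfp ?f = lfp ?g"
      by (rule gfp_dual[OF nested_update_mono sub nested_update_mono sub dual])
    then show ?thesis
      using True by simp
  next
    case False
    have "?S - gfp ?g = lfp ?f"
      by (rule gfp_dual[OF nested_update_mono sub nested_update_mono sub dual'])
    moreover have "gfp ?g \<subseteq> ?S"
      by (subst gfp_unfold[OF nested_update_mono]) (rule sub)
    ultimately show ?thesis
      using False by auto
  qed
qed

text \<open>The invariant for the induction over the nesting depth: priorities below
  \<open>d\<close> are already ranked, with digits below position \<open>d\<close> only, while those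
  from \<open>d\<close> on merely have to be left into the parameter \<open>X\<close>.\<close>

definition partial_measure ::
  "'v game \<Rightarrow> player \<Rightarrow> nat \<Rightarrow> nat \<Rightarrow> (nat \<Rightarrow> 'v set) \<Rightarrow> ('v \<Rightarrow> nat) \<Rightarrow> 'v set \<Rightarrow> bool" where
  "partial_measure G p b d X \<rho> Y \<longleftrightarrow>
     (\<forall>v\<in>Y. \<rho> v < b ^ d \<and>
        v \<in> cpre G p {u. if prio G v < d then u \<in> Y \<and> rank_ok G p b \<rho> v u else u \<in> X (prio G v)})"

text \<open>The digit at position \<open>d\<close> is the stage at which a vertex enters the
  iteration; the lower digits come from the measure belonging to that stage. Leaving priority
  \<open>d\<close> leads to an earlier stage, the strict decrease an unfavourable priority demands.
  Lower priorities never lead to a later stage.\<close>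

lemma partial_measure_lfp:
  assumes Y0: "Y 0 = {}" and b: "b = Suc m" and unfav: "\<not> favours p d"
    and w: "\<And>i. partial_measure G p b d (X(d := Y i)) (\<rho> i) (Y (Suc i))"
    and mono: "\<And>i j. i \<le> j \<Longrightarrow> Y i \<subseteq> Y j"
  shows "\<exists>\<rho>'. partial_measure G p b (Suc d) X \<rho>' (Y m)"
proof -
  define st where "st v = (LEAST i. v \<in> Y (Suc i))" for v
  define r where "r v = st v * b ^ d + \<rho> (st v) v" for v
  \<comment> \<open>Stages count from 0 although \<open>Y 0\<close> is empty: \<open>v\<close> first
    occurs in \<open>Y (Suc (st v))\<close>, and its obligation at priority \<open>d\<close> refers
    to \<open>Y (st v)\<close>.\<close>
  have st: "v \<in> Y (Suc (st v)) \<and> st v < i" if v: "v \<in> Y i" for v i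
  proof -
    obtain k where k: "i = Suc k" using v Y0 by (cases i) auto
    show ?thesis
      using v unfolding k st_def by (metis LeastI Least_le less_Suc_eq_le)
  qed
  have bpos: "b > 0" using b by simp
  have rho: "\<rho> (st v) v < b ^ d" if "v \<in> Y i" for v i
    using st[OF that] w[of "st v"] unfolding partial_measure_def by blast
  have rdiv: "r v div b ^ d = st v" if "v \<in> Y i" for v i
    using rho[OF that] bpos unfolding r_def by simp
  have rdivj: "r v div b ^ j = st v * b ^ (d - j) + \<rho> (st v) v div b ^ j" if "j \<le> d" for v j
  proof -
    have "b ^ d = b ^ (d - j) * b ^ j"
      using that by (simp add: power_add[symmetric])
    then show ?thesis
      unfolding r_def using bpos by (simp add: mult.assoc[symmetric])
  qed
  \<comment> \<open>A smaller stage outweighs all lower digits, as these amount to less than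
    \<open>b ^ d\<close>; the gap survives division by \<open>b ^ j\<close> because
    \<open>b ^ j\<close> divides the stage part.\<close>
  have less: "r u div b ^ j < r v div b ^ j" if "j \<le> d" "u \<in> Y k" "st u < st v" for u v j k
  proof -
    have e: "b ^ d = b ^ (d - j) * b ^ j"
      using that by (simp add: power_add[symmetric])
    have "r u < (st u + 1) * b ^ d"
      using rho[OF that(2)] unfolding r_def by simp
    also have "\<dots> \<le> st v * b ^ d"
      using that(3) by (intro mult_right_mono) auto
    finally have "r u < st v * b ^ (d - j) * b ^ j"
      by (simp add: e mult.assoc)
    then have "r u div b ^ j < st v * b ^ (d - j)"
      by (rule less_mult_imp_div_less)
    then show ?thesis using rdivj[OF that(1), of v] by linarith
  qed
  have "partial_measure G p b (Suc d) X r (Y m)"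
    unfolding partial_measure_def
  proof (intro ballI conjI)
    fix v assume v: "v \<in> Y m"
    let ?i = "st v" and ?j = "prio G v"
    have "r v < (st v + 1) * b ^ d"
      using rho[OF v] unfolding r_def by simp
    also have "\<dots> \<le> b * b ^ d"
      using st[OF v] b by (intro mult_right_mono) auto
    finally show "r v < b ^ Suc d" by simp
    have mem: "v \<in> cpre G p {u. if ?j < d then u \<in> Y (Suc ?i) \<and> rank_ok G p b (\<rho> ?i) v u
        else u \<in> (X(d := Y ?i)) ?j}"
      using w[of ?i] st[OF v] unfolding partial_measure_def by blast
    have "(if ?j < Suc d then u \<in> Y m \<and> rank_ok G p b r v u else u \<in> X ?j)"
      if u: "if ?j < d then u \<in> Y (Suc ?i) \<and> rank_ok G p b (\<rho> ?i) v u
        else u \<in> (X(d := Y ?i)) ?j" for u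
    proof -
      consider "?j < d" | "?j = d" | "?j > d" by linarith
      then show ?thesis
      proof cases
        case 1
        then have uY: "u \<in> Y (Suc ?i)" and ok: "rank_ok G p b (\<rho> ?i) v u"
          using u by auto
        have "u \<in> Y m"
          using uY mono[of "Suc ?i" m] st[OF v] by auto
        \<comment> \<open>A smaller stage of \<open>u\<close> is a strict decrease. At equal stages
          both ranks use the same measure \<open>\<rho> ?i\<close>, and the common top digit
          cancels.\<close>
        moreover have "rank_ok G p b r v u"
        proof (cases "st u < ?i")
          case True
          then show ?thesis
            using less[OF _ uY True, of ?j] 1 unfolding rank_ok_def by (auto simp: less_imp_le)
        next
          case False
          then have "st u = ?i" using st[OF uY] by simp
          then show ?thesis
            using ok 1 unfolding rank_ok_def by (auto simp: rdivj split: if_splits)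
        qed
        ultimately show ?thesis using 1 by simp
      next
        case 2
        then have uY: "u \<in> Y ?i" using u by simp
        then have "st u < ?i" using st by blast
        moreover have "u \<in> Y m"
          using uY mono[of ?i m] st[OF v] by auto
        ultimately show ?thesis
          using 2 unfav rdiv[OF uY] rdiv[OF v] unfolding rank_ok_def by simp
      next
        case 3
        then show ?thesis using u by auto
      qed
    qed
    then have "{u. if ?j < d then u \<in> Y (Suc ?i) \<and> rank_ok G p b (\<rho> ?i) v u
        else u \<in> (X(d := Y ?i)) ?j} \<subseteq>
        {u. if ?j < Suc d then u \<in> Y m \<and> rank_ok G p b r v u else u \<in> X ?j}"
      by (intro Collect_mono impI)
    from subsetD[OF cpre_mono[OF this] mem]
    show "v \<in> cpre G p {u. if ?j < Suc d then u \<in> Y m \<and> rank_ok G p b r v u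
        else u \<in> X ?j}" .
  qed
  then show ?thesis by blast
qed

text \<open>A greatest fixpoint keeps the measure obtained for its own value as parameter; a least
  fixpoint adds a digit for the stage. The iteration closes at stage \<open>card (verts G)\<close>,
  so this digit stays below \<open>b\<close>.\<close>

lemma partial_measure_nested:
  assumes G: "game_graph G" and b: "b = Suc (card (verts G))"
  shows "\<exists>\<rho>. partial_measure G p b d X \<rho> (nested G p d X)"
proof (induction d arbitrary: X)
  case 0
  then show ?case
    unfolding partial_measure_def by (intro exI[of _ "\<lambda>_. 0"]) simp
next
  case (Suc d)
  let ?f = "\<lambda>Y. nested G p d (X(d := Y))"
  note mono = nested_update_mono[of G p d X]
  show ?case
  proof (cases "favours p d")
    case True
    let ?Y = "gfp ?f"
    have Y: "?Y = ?f ?Y" by (rule gfp_unfold[OF mono])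
    obtain \<rho> where \<rho>: "partial_measure G p b d (X(d := ?Y)) \<rho> ?Y"
      using Suc[of "X(d := ?Y)"] unfolding Y[symmetric] by blast
    have "partial_measure G p b (Suc d) X \<rho> ?Y"
      unfolding partial_measure_def
    proof (intro ballI conjI)
      fix v assume v: "v \<in> ?Y"
      then have lt: "\<rho> v < b ^ d" using \<rho> unfolding partial_measure_def by blast
      also have "\<dots> \<le> b ^ Suc d" using b by simp
      finally show "\<rho> v < b ^ Suc d" .
      have "v \<in> cpre G p {u. if prio G v < d then u \<in> ?Y \<and> rank_ok G p b \<rho> v u
          else u \<in> (X(d := ?Y)) (prio G v)}"
        using \<rho> v unfolding partial_measure_def by blast
      \<comment> \<open>The case to check is priority \<open>d\<close>: both ranks lie below
        \<open>b ^ d\<close>, so both quotients are 0, which suffices for a favourable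
        priority.\<close>
      moreover have "{u. if prio G v < d then u \<in> ?Y \<and> rank_ok G p b \<rho> v u
          else u \<in> (X(d := ?Y)) (prio G v)} \<subseteq> {u. if prio G v < Suc d
          then u \<in> ?Y \<and> rank_ok G p b \<rho> v u else u \<in> X (prio G v)}"
        using True \<rho> unfolding rank_ok_def partial_measure_def
        by (auto simp: not_less less_Suc_eq)
      ultimately show "v \<in> cpre G p {u. if prio G v < Suc d
          then u \<in> ?Y \<and> rank_ok G p b \<rho> v u else u \<in> X (prio G v)}"
        by (rule subsetD[OF cpre_mono, rotated])
    qed
    then show ?thesis using True by auto
  next
    case False
    let ?Y = "\<lambda>i. (?f ^^ i) {}"
    have "\<forall>i. \<exists>\<rho>. partial_measure G p b d (X(d := ?Y i)) \<rho> (?Y (Suc i))"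
      using Suc by simp
    then obtain \<rho> where "\<And>i. partial_measure G p b d (X(d := ?Y i)) (\<rho> i) (?Y (Suc i))"
      by metis
    moreover have "?Y i \<subseteq> ?Y j" if "i \<le> j" for i j
      using funpow_decreasing[OF that mono] by (simp add: bot_set_def)
    ultimately have "\<exists>\<rho>. partial_measure G p b (Suc d) X \<rho> (?Y (card (verts G)))"
      by (intro partial_measure_lfp[where Y = ?Y] b False) auto
    moreover have "lfp ?f = ?Y (card (verts G))"
      using G by (intro lfp_eq_funpow_card mono nested_subset_verts) (auto simp: game_graph_def)
    ultimately show ?thesis using False by simp
  qed
qed

text \<open>At level \<open>c\<close> all priorities are ranked, so a partial measure is a progress
  measure whatever its parameter. The empty parameter for \<open>p\<close> dualises to
  \<open>verts G\<close> for the opponent. Only \<open>\<rho>\<close> needs a bound, as it alone is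
  compared with computed ranks.\<close>

theorem small_progress_measures:
  assumes G: "game_graph G" and c: "\<And>v. v \<in> verts G \<Longrightarrow> prio G v < c"
    and b: "b = Suc (card (verts G))"
  obtains Y \<rho> \<rho>' where "Y \<subseteq> verts G"
    "progress_measure G p b \<rho> Y" "\<And>v. v \<in> Y \<Longrightarrow> \<rho> v < b ^ c"
    "progress_measure G (opponent p) b \<rho>' (verts G - Y)"
proof -
  have pm: "progress_measure G q b \<rho> Y"
    if "partial_measure G q b c X \<rho> Y" "Y \<subseteq> verts G" for q X \<rho> Y
    unfolding progress_measure_def
  proof
    fix v assume "v \<in> Y"
    moreover from this have "prio G v < c" using that(2) c by blast
    ultimately show "v \<in> cpre G q {u \<in> Y. rank_ok G q b \<rho> v u}"
      using that(1) unfolding partial_measure_def by auto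
  qed
  let ?Y = "nested G p c (\<lambda>_. {})"
  have sub: "?Y \<subseteq> verts G" by (rule nested_subset_verts[OF G])
  obtain \<rho> where \<rho>: "partial_measure G p b c (\<lambda>_. {}) \<rho> ?Y"
    using partial_measure_nested[OF G b] by blast
  obtain \<rho>' where \<rho>': "partial_measure G (opponent p) b c (\<lambda>_. verts G) \<rho>' (verts G - ?Y)"
    using partial_measure_nested[OF G b] nested_dual[OF G, of "\<lambda>_. {}"]
    by (metis Diff_empty empty_subsetI)
  show thesis
    using that[of ?Y \<rho> \<rho>'] sub \<rho> \<rho>' pm[OF \<rho> sub] pm[OF \<rho>']
    unfolding partial_measure_def by blast
qed

section \<open>Lifting on a stable partition\<close>

text \<open>The offset \<open>e\<close> unifies the two comparisons of Even's measure: with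
  \<open>e = d\<close> the test \<open>r a' < r a + e\<close> is the weak one on quotients, with
  \<open>e = 0\<close> the strict one.\<close>

definition class_attrs :: "'v game \<Rightarrow> nat \<Rightarrow> 'v set \<Rightarrow> nat \<Rightarrow> nat \<Rightarrow> nat \<Rightarrow> bool" where
  "class_attrs G b A d e w \<longleftrightarrow>
     (\<forall>v\<in>A. d = b ^ prio G v \<and> e = (if even (prio G v) then d else 0) \<and>
        w = of_bool (v \<in> owned G Even))"

text \<open>The set \<open>S\<close> allows a partition of only part of the graph, as it arises
  while the priorities are read. Nonemptiness bounds the number of classes, and with it registers
  and rounds.\<close>

definition classes :: "'v game \<Rightarrow> nat \<Rightarrow> 'v set \<Rightarrow> nat \<Rightarrow> (nat \<Rightarrow> 'v set) \<Rightarrow>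
    (nat \<Rightarrow> nat) \<Rightarrow> (nat \<Rightarrow> nat) \<Rightarrow> (nat \<Rightarrow> nat) \<Rightarrow> bool" where
  "classes G b S q B d e w \<longleftrightarrow>
     (\<Union>a<q. B a) = S \<and>
     (\<forall>a<q. B a \<noteq> {} \<and> class_attrs G b (B a) (d a) (e a) (w a)) \<and>
     (\<forall>a<q. \<forall>a'<q. a \<noteq> a' \<longrightarrow> B a \<inter> B a' = {})"

definition stable_edges :: "'v game \<Rightarrow> nat \<Rightarrow> (nat \<Rightarrow> 'v set) \<Rightarrow> (nat \<Rightarrow> nat \<Rightarrow> bool) \<Rightarrow> bool" where
  "stable_edges G q B E \<longleftrightarrow>
     (\<forall>a<q. \<forall>a'<q. B a \<inter> pre G (B a') = (if E a a' then B a else {}))"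

definition lifted :: "nat \<Rightarrow> (nat \<Rightarrow> nat \<Rightarrow> bool) \<Rightarrow> (nat \<Rightarrow> nat) \<Rightarrow> (nat \<Rightarrow> nat) \<Rightarrow> (nat \<Rightarrow> nat) \<Rightarrow>
    nat \<Rightarrow> bool" where
  "lifted q E e w r a \<longleftrightarrow>
     (if w a = 0 then \<forall>a'<q. E a a' \<longrightarrow> r a' < r a + e a
      else \<exists>a'<q. E a a' \<and> r a' < r a + e a)"

lemma classes_card_le:
  assumes "classes G b S q B d e w" "finite S"
  shows "q \<le> card S"
proof -
  have U: "(\<Union>a<q. B a) = S" and ne: "\<And>a. a < q \<Longrightarrow> B a \<noteq> {}"
    and disj: "\<And>a a'. a < q \<Longrightarrow> a' < q \<Longrightarrow> a \<noteq> a' \<Longrightarrow> B a \<inter> B a' = {}"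
    using assms(1) unfolding classes_def by blast+
  define f where "f a = (SOME v. v \<in> B a)" for a
  have f: "f a \<in> B a" if "a < q" for a
    using ne[OF that] unfolding f_def by (simp add: some_in_eq)
  have "inj_on f {..<q}"
    using f disj by (fastforce intro!: inj_onI)
  moreover have "f ` {..<q} \<subseteq> S"
    using f U by blast
  ultimately show ?thesis
    using card_inj_on_le[of f "{..<q}" S] assms(2) by simp
qed

lemma classes_add:
  assumes "classes G b S q B d e w" "N \<noteq> {}" "N \<inter> S = {}" "class_attrs G b N d' e' w'"
  shows "classes G b (S \<union> N) (Suc q) (B(q := N)) (d(q := d')) (e(q := e')) (w(q := w'))"
proof -
  have U: "(\<Union>a<q. B a) = S" and ne: "\<And>a. a < q \<Longrightarrow> B a \<noteq> {} \<and> class_attrs G b (B a) (d a) (e a) (w a)"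
    and disj: "\<And>a a'. a < q \<Longrightarrow> a' < q \<Longrightarrow> a \<noteq> a' \<Longrightarrow> B a \<inter> B a' = {}"
    using assms(1) unfolding classes_def by blast+
  have "B a \<inter> N = {}" if "a < q" for a
    using that U assms(3) by blast
  then show ?thesis
    using U ne disj assms(2,4) unfolding classes_def
    by (auto simp: less_Suc_eq lessThan_Suc)
qed

lemma class_attrs_subset:
  assumes "class_attrs G b A d e w" "A' \<subseteq> A"
  shows "class_attrs G b A' d e w"
  using assms unfolding class_attrs_def by blast

lemma classes_split:
  assumes "classes G b S q B d e w" "a < q" "D \<subseteq> B a" "D \<noteq> {}" "D \<noteq> B a"
  shows "classes G b S (Suc q) (B(a := B a - D, q := D))
    (d(q := d a)) (e(q := e a)) (w(q := w a))"
proof -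
  have U: "(\<Union>a<q. B a) = S" and ne: "\<And>a. a < q \<Longrightarrow> B a \<noteq> {} \<and> class_attrs G b (B a) (d a) (e a) (w a)"
    and disj: "\<And>a a'. a < q \<Longrightarrow> a' < q \<Longrightarrow> a \<noteq> a' \<Longrightarrow> B a \<inter> B a' = {}"
    using assms(1) unfolding classes_def by blast+
  let ?B = "B(a := B a - D, q := D)"
  have "(\<Union>a'<Suc q. ?B a') = (\<Union>a'<q. (B(a := B a - D)) a') \<union> D"
    by (auto simp: less_Suc_eq lessThan_Suc)
  also have "\<dots> = S"
  proof
    show "(\<Union>a'<q. (B(a := B a - D)) a') \<union> D \<subseteq> S"
      using U assms(2,3) by (auto split: if_splits)
    show "S \<subseteq> (\<Union>a'<q. (B(a := B a - D)) a') \<union> D"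
      using U by force
  qed
  finally have 1: "(\<Union>a'<Suc q. ?B a') = S" .
  have 2: "?B a' \<noteq> {} \<and> class_attrs G b (?B a') ((d(q := d a)) a') ((e(q := e a)) a') ((w(q := w a)) a')"
    if "a' < Suc q" for a'
  proof -
    have "class_attrs G b (B a - D) (d a) (e a) (w a)" "class_attrs G b D (d a) (e a) (w a)"
      using ne[OF assms(2)] class_attrs_subset assms(3) by blast+
    moreover have "B a - D \<noteq> {}"
      using assms(3,5) by blast
    ultimately show ?thesis
      using that ne[of a'] assms(2,4) by (cases "a' = q"; cases "a' = a") auto
  qed
  have 3: "?B a' \<inter> ?B a'' = {}" if "a' < Suc q" "a'' < Suc q" "a' \<noteq> a''" for a' a''
    using that disj[of a' a''] disj[of a a''] disj[of a' a] assms(2,3)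
    by (auto simp: less_Suc_eq split: if_splits)
  show ?thesis
    unfolding classes_def using 1 2 3 by blast
qed

text \<open>Ranks of classes are multiples of \<open>d a = b ^ i\<close>, where \<open>i\<close> is the priority of the class, so
  comparing quotients by \<open>b ^ i\<close> amounts to comparing with \<open>r a + e a\<close>.\<close>

lemma div_le_iff_less_add:
  fixes x y d :: nat
  assumes "d dvd y" "d > 0"
  shows "x div d \<le> y div d \<longleftrightarrow> x < y + d" "x div d < y div d \<longleftrightarrow> x < y"
proof -
  obtain k where k: "y = k * d" using assms(1) by (metis dvd_div_mult_self)
  have "x div d \<le> k \<longleftrightarrow> x < Suc k * d" for k
    using assms(2) by (metis div_less_iff_less_mult less_Suc_eq_le)
  then show "x div d \<le> y div d \<longleftrightarrow> x < y + d"
    using assms(2) k by (simp add: add.commute)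
  show "x div d < y div d \<longleftrightarrow> x < y"
    using assms(2) k by (simp add: div_less_iff_less_mult)
qed

text \<open>Were \<open>\<rho> v\<close> below the raised rank, \<open>\<rho> v\<close> and
  \<open>r a\<close> would have the same quotient by \<open>d a\<close>. The successors that justify
  \<open>\<rho>\<close> at \<open>v\<close> would then, having class ranks at most their
  \<open>\<rho>\<close>, justify \<open>r\<close> at \<open>a\<close>; stability turns edges of
  \<open>v\<close> into edges of the class and back.\<close>

lemma lift_below_measure:
  assumes G: "game_graph G" and b: "b > 0"
    and cl: "classes G b (verts G) q B d e w" and st: "stable_edges G q B E"
    and pm: "progress_measure G Even b \<rho> Y" and Y: "Y \<subseteq> verts G"
    and r: "\<And>a v. a < q \<Longrightarrow> v \<in> B a \<inter> Y \<Longrightarrow> r a \<le> \<rho> v"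
    and dvd: "d a dvd r a" and a: "a < q" and nl: "\<not> lifted q E e w r a"
    and v: "v \<in> B a \<inter> Y"
  shows "r a + d a \<le> \<rho> v"
proof (rule ccontr)
  assume "\<not> ?thesis"
  then have less: "\<rho> v < r a + d a" by simp
  have attr: "d a = b ^ prio G v" "e a = (if even (prio G v) then d a else 0)"
      "w a = of_bool (v \<in> owned G Even)"
    using cl a v unfolding classes_def class_attrs_def by blast+
  have dpos: "d a > 0" using attr b by simp
  have ra: "r a \<le> \<rho> v" using r a v by blast
  have quot: "\<rho> v div d a = r a div d a"
    using div_le_iff_less_add(1)[OF dvd dpos, of "\<rho> v"] less div_le_mono[OF ra, of "d a"] by simp
  have key: "r a' < r a + e a"
    if "a' < q" "u \<in> B a'" "u \<in> Y" "rank_ok G Even b \<rho> v u" for a' u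
  proof -
    have "\<rho> u < r a + e a"
      using that(4) attr div_le_iff_less_add[OF dvd dpos, of "\<rho> u"] quot
      unfolding rank_ok_def by (auto split: if_splits)
    then show ?thesis using r[of a' u] that by auto
  qed
  have mem: "v \<in> cpre G Even {u \<in> Y. rank_ok G Even b \<rho> v u}"
    using pm v unfolding progress_measure_def by blast
  have edge: "E a a'" if "u \<in> out G v" "u \<in> B a'" "a' < q" for u a'
  proof -
    have "v \<in> B a \<inter> pre G (B a')"
      using that v unfolding pre_def out_def by auto
    then show ?thesis
      using st a that(3) unfolding stable_edges_def by (metis empty_iff)
  qed
  show False
  proof (cases "v \<in> owned G Even")
    case True
    then have "out G v \<inter> {u \<in> Y. rank_ok G Even b \<rho> v u} \<noteq> {}"
      using mem owned_player_Un[OF G, of Even] unfolding cpre_def by auto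
    then obtain u where u: "u \<in> out G v" "u \<in> Y" "rank_ok G Even b \<rho> v u" by blast
    then obtain a' where a': "a' < q" "u \<in> B a'"
      using cl Y unfolding classes_def by blast
    show False
      using nl attr True key[OF a' u(2,3)] edge[OF u(1) a'(2,1)] a'(1)
      unfolding lifted_def by auto
  next
    case False
    then have sub: "out G v \<subseteq> {u \<in> Y. rank_ok G Even b \<rho> v u}"
      using mem unfolding cpre_def by auto
    obtain a' where a': "a' < q" "E a a'" "\<not> r a' < r a + e a"
      using nl attr False unfolding lifted_def by auto
    have "v \<in> pre G (B a')"
      using st a a' v unfolding stable_edges_def by (metis IntD1 IntD2)
    then obtain u where u: "u \<in> B a'" "u \<in> out G v"
      unfolding pre_def out_def by auto
    then show False
      using key[OF a'(1) u(1)] sub a'(3) by blast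
  qed
qed

lemma lifted_progress_measure:
  assumes G: "game_graph G" and b: "b > 0" and c: "\<And>v. v \<in> verts G \<Longrightarrow> prio G v < c"
    and cl: "classes G b (verts G) q B d e w" and st: "stable_edges G q B E"
    and dvd: "\<And>a. a < q \<Longrightarrow> d a dvd r a"
    and l: "\<And>a. a < q \<Longrightarrow> r a < b ^ c \<Longrightarrow> lifted q E e w r a"
  shows "\<exists>\<rho>. progress_measure G Even b \<rho> (\<Union>a\<in>{a. a < q \<and> r a < b ^ c}. B a)"
proof -
  let ?Y = "\<Union>a\<in>{a. a < q \<and> r a < b ^ c}. B a"
  have U: "(\<Union>a<q. B a) = verts G"
    and disj: "\<And>a a'. a < q \<Longrightarrow> a' < q \<Longrightarrow> a \<noteq> a' \<Longrightarrow> B a \<inter> B a' = {}"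
    using cl unfolding classes_def by blast+
  define k where "k v = (SOME a. a < q \<and> v \<in> B a)" for v
  have k: "k v = a" if "a < q" "v \<in> B a" for v a
    using someI[of "\<lambda>a. a < q \<and> v \<in> B a" a] that disj unfolding k_def by blast
  have "v \<in> cpre G Even {u \<in> ?Y. rank_ok G Even b (\<lambda>v. r (k v)) v u}" if v: "v \<in> ?Y" for v
  proof -
    obtain a where a: "a < q" "r a < b ^ c" "v \<in> B a" using v by auto
    have attr: "d a = b ^ prio G v" "e a = (if even (prio G v) then d a else 0)"
        "w a = of_bool (v \<in> owned G Even)"
      using cl a unfolding classes_def class_attrs_def by blast+
    have vV: "v \<in> verts G" using U a by blast
    have dpos: "d a > 0" using attr b by simp
    have "d a dvd b ^ c - r a"
      using attr c[OF vV] dvd[OF a(1)] by (simp add: le_imp_power_dvd dvd_diff_nat)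
    then have "d a \<le> b ^ c - r a"
      using a(2) by (simp add: dvd_imp_le)
    then have top: "r a + e a \<le> b ^ c"
      using attr(2) a(2) by (auto split: if_splits)
    have ok: "u \<in> ?Y \<and> rank_ok G Even b (\<lambda>v. r (k v)) v u"
      if "a' < q" "u \<in> B a'" "r a' < r a + e a" for a' u
    proof
      show "u \<in> ?Y" using that top by auto
      show "rank_ok G Even b (\<lambda>v. r (k v)) v u"
        using that attr k[OF a(1,3)] k[OF that(1,2)] div_le_iff_less_add[OF dvd[OF a(1)] dpos, of "r a'"]
        unfolding rank_ok_def by (auto split: if_splits)
    qed
    have l: "lifted q E e w r a" using l a by blast
    show ?thesis
    proof (cases "v \<in> owned G Even")
      case True
      then obtain a' where a': "a' < q" "E a a'" "r a' < r a + e a"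
        using l attr unfolding lifted_def by auto
      have "v \<in> pre G (B a')"
        using st a a' unfolding stable_edges_def by (metis IntD2)
      then obtain u where u: "u \<in> B a'" "u \<in> out G v"
        unfolding pre_def out_def by auto
      then show ?thesis
        using ok[OF a'(1) u(1) a'(3)] True unfolding cpre_def by auto
    next
      case False
      have "u \<in> ?Y \<and> rank_ok G Even b (\<lambda>v. r (k v)) v u" if u: "u \<in> out G v" for u
      proof -
        obtain a' where a': "a' < q" "u \<in> B a'"
          using U u out_subset_verts[OF G] by blast
        have "v \<in> B a \<inter> pre G (B a')"
          using a' u a unfolding pre_def out_def by auto
        then have "E a a'"
          using st a(1) a'(1) unfolding stable_edges_def by (metis empty_iff)
        then have "r a' < r a + e a"
          using l a'(1) attr False unfolding lifted_def by auto
        then show ?thesis using ok[OF a'] by blast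
      qed
      moreover have "v \<in> owned G Odd"
        using False vV owned_player_Un[OF G, of Even] by auto
      ultimately show ?thesis
        unfolding cpre_def by auto
    qed
  qed
  then show ?thesis
    unfolding progress_measure_def by blast
qed

text \<open>Each of the two unions of classes lies in the winning set of its player. They cover the
  graph and the winning sets are disjoint, so equality holds.\<close>

lemma lifted_winning_sets:
  assumes G: "game_graph G" and b: "b > 0" and c: "\<And>v. v \<in> verts G \<Longrightarrow> prio G v < c"
    and cl: "classes G b (verts G) q B d e w" and st: "stable_edges G q B E"
    and dvd: "\<And>a. a < q \<Longrightarrow> d a dvd r a"
    and l: "\<And>a. a < q \<Longrightarrow> r a < b ^ c \<Longrightarrow> lifted q E e w r a"
    and r: "\<And>a v. a < q \<Longrightarrow> v \<in> B a \<inter> Y \<Longrightarrow> r a \<le> \<rho> v"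
    and \<rho>: "\<And>v. v \<in> Y \<Longrightarrow> \<rho> v < b ^ c"
    and pm: "progress_measure G Odd b \<rho>' (verts G - Y)"
  shows "winning_set G Even = (\<Union>a\<in>{a. a < q \<and> r a < b ^ c}. B a)"
    and "winning_set G Odd = (\<Union>a\<in>{a. a < q \<and> \<not> r a < b ^ c}. B a)"
proof -
  let ?W = "\<Union>a\<in>{a. a < q \<and> r a < b ^ c}. B a" and ?L = "\<Union>a\<in>{a. a < q \<and> \<not> r a < b ^ c}. B a"
  have U: "?W \<union> ?L = verts G"
    using cl unfolding classes_def by blast
  have W: "?W \<subseteq> winning_set G Even"
  proof -
    obtain \<rho>'' where "progress_measure G Even b \<rho>'' ?W"
      using lifted_progress_measure[OF G b c cl st dvd l] by blast
    then show ?thesis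
      using progress_measure_winning[OF G c _ _ b, of ?W Even] U by blast
  qed
  \<comment> \<open>A rank that reached the top cannot be below \<open>\<rho>\<close>, so the class
    avoids \<open>Y\<close>, and the measure of Odd applies.\<close>
  have "?L \<subseteq> verts G - Y"
  proof
    fix v assume "v \<in> ?L"
    then obtain a where a: "a < q" "\<not> r a < b ^ c" "v \<in> B a" by blast
    then have "v \<notin> Y"
      using r[of a v] \<rho>[of v] by auto
    then show "v \<in> verts G - Y"
      using U \<open>v \<in> ?L\<close> by blast
  qed
  then have L: "?L \<subseteq> winning_set G Odd"
    using progress_measure_winning[OF G c _ pm b] by blast
  have V: "winning_set G Even \<subseteq> verts G" "winning_set G Odd \<subseteq> verts G"
    unfolding winning_set_def by auto
  have "W' = W \<and> L' = L"
    if "W \<union> L = S" "W \<subseteq> W'" "L \<subseteq> L'" "W' \<subseteq> S" "L' \<subseteq> S" "W' \<inter> L' = {}" for W W' L L' S :: "'a set"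
    using that by blast
  from this[OF U W L V winning_sets_disjoint[OF G]]
  show "winning_set G Even = ?W" "winning_set G Odd = ?L"
    by simp_all
qed

section \<open>Total correctness of programs\<close>

fun loop_free :: "com \<Rightarrow> bool" where
  "loop_free (Seq c d) \<longleftrightarrow> loop_free c \<and> loop_free d"
| "loop_free (Cond b c d) \<longleftrightarrow> loop_free c \<and> loop_free d"
| "loop_free (While b c) \<longleftrightarrow> False"
| "loop_free _ \<longleftrightarrow> True"

text \<open>The value on a loop is irrelevant.\<close>

fun run :: "'v game \<Rightarrow> com \<Rightarrow> 'v state \<Rightarrow> 'v state" where
  "run G Skip s = s"
| "run G (Assign x e f) s = assign_num x (nval e (nums s)) (nval f (nums s)) s"
| "run G (SetOp r g r1 r2) s =
     count_set_op {addr r (nums s), addr r1 (nums s), addr r2 (nums s)}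
       (assign_reg (addr r (nums s))
         (set_fun_val g (regs s (addr r1 (nums s))) (regs s (addr r2 (nums s)))) s)"
| "run G (SetTest x e g r1 r2) s =
     count_set_op {addr r1 (nums s), addr r2 (nums s)}
       (assign_num x (nval e (nums s))
         (of_bool (set_test_val g (regs s (addr r1 (nums s))) (regs s (addr r2 (nums s))))) s)"
| "run G (PreOp r r1) s =
     count_one_step {addr r (nums s), addr r1 (nums s)}
       (assign_reg (addr r (nums s)) (pre G (regs s (addr r1 (nums s)))) s)"
| "run G (CPreOp p r r1) s =
     count_one_step {addr r (nums s), addr r1 (nums s)}
       (assign_reg (addr r (nums s)) (cpre G p (regs s (addr r1 (nums s)))) s)"
| "run G (Seq c d) s = run G d (run G c s)"
| "run G (Cond b c d) s = (if bval b (nums s) then run G c s else run G d s)"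
| "run G (While b c) s = s"

lemma exec_run: "loop_free c \<Longrightarrow> exec G c s (run G c s)"
proof (induction c arbitrary: s)
  case (SetTest x e g r1 r2)
  show ?case
    unfolding run.simps by (rule exec.SetTest) simp_all
qed (auto intro: exec.intros)

lemma exec_While_total:
  fixes \<mu> :: "'v state \<Rightarrow> nat"
  assumes body: "\<And>s. I s \<Longrightarrow> bval b (nums s) \<Longrightarrow> \<exists>t. exec G c s t \<and> I t \<and> \<mu> t < \<mu> s"
    and "I s"
  shows "\<exists>t. exec G (While b c) s t \<and> I t \<and> \<not> bval b (nums t)"
  using assms(2)
proof (induction "\<mu> s" arbitrary: s rule: less_induct)
  case less
  show ?case
  proof (cases "bval b (nums s)")
    case True
    then obtain s' where s': "exec G c s s'" "I s'" "\<mu> s' < \<mu> s"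
      using body less.prems by blast
    then show ?thesis
      using less.hyps[of s'] True exec.WhileTrue by blast
  next
    case False
    then show ?thesis using less.prems exec.WhileFalse by blast
  qed
qed

lemmas step_simps = assign_num_def assign_reg_def count_one_step_def count_set_op_def

section \<open>The algorithm\<close>

text \<open>Number cells: \<open>q\<close> classes so far; \<open>d\<close>, \<open>e\<close>, \<open>o\<close> the attributes and \<open>r\<close> the rank of a class;
  \<open>M\<close> the quotient edges, where the pair \<open>(a, a')\<close> is stored at \<open>a * n + a'\<close>; \<open>w = (n + 1) ^ i\<close> and
  \<open>m\<close> the parity flag of the priority \<open>i\<close> being read, so that \<open>w\<close> ends up as the top rank.
  The register \<open>Z\<close> is never written and serves as the empty set.\<close>

abbreviation var :: "vname \<Rightarrow> nexp" where
  "var x \<equiv> Cell x (Num 0)"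

text \<open>The intersection is formed in the first free register; if it is empty, \<open>q\<close>
  does not advance and the register is reused. Hence the indices \<open>{..n}\<close> in
  \<open>regs_bound\<close>, although there are at most \<open>n\<close> classes.\<close>

definition add_class :: "vname \<Rightarrow> nat \<Rightarrow> com" where
  "add_class X f =
     Seq (SetOp (Reg ''B'' (var ''q'')) SInter (Reg ''P'' (var ''i'')) (Reg X (Num 0)))
    (Seq (SetTest ''t'' (Num 0) SEqual (Reg ''B'' (var ''q'')) (Reg ''Z'' (Num 0)))
         (Cond (Eq (var ''t'') (Num 0))
           (Seq (Assign ''d'' (var ''q'') (var ''w''))
           (Seq (Assign ''e'' (var ''q'') (Times (var ''m'') (var ''w'')))
           (Seq (Assign ''o'' (var ''q'') (Num f))
                (Assign ''q'' (Num 0) (Plus (var ''q'') (Num 1))))))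
           Skip))"

definition init_body :: com where
  "init_body =
     Seq (add_class ''VE'' 1)
    (Seq (add_class ''VO'' 0)
    (Seq (Assign ''w'' (Num 0) (Times (var ''w'') (Plus (var ''n'') (Num 1))))
    (Seq (Assign ''m'' (Num 0) (Minus (Num 1) (var ''m'')))
         (Assign ''i'' (Num 0) (Plus (var ''i'') (Num 1))))))"

definition init_prog :: com where
  "init_prog =
     Seq (Assign ''w'' (Num 0) (Num 1))
    (Seq (Assign ''m'' (Num 0) (Num 1))
         (While (Less (var ''i'') (var ''c'')) init_body))"

definition edge_cell :: "vname \<Rightarrow> vname \<Rightarrow> nexp" where
  "edge_cell x y = Plus (Times (var x) (var ''n'')) (var y)"

text \<open>The union of \<open>D\<close> with itself copies a register. A split may destroy facts
  already checked about either half, as source or as splitter, so the scan restarts with splitter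
  0.\<close>

definition split_class :: com where
  "split_class =
     Seq (SetOp (Reg ''B'' (var ''q'')) SUnion (Reg ''D'' (Num 0)) (Reg ''D'' (Num 0)))
    (Seq (SetOp (Reg ''B'' (var ''a'')) SDiff (Reg ''B'' (var ''a'')) (Reg ''D'' (Num 0)))
    (Seq (Assign ''d'' (var ''q'') (Cell ''d'' (var ''a'')))
    (Seq (Assign ''e'' (var ''q'') (Cell ''e'' (var ''a'')))
    (Seq (Assign ''o'' (var ''q'') (Cell ''o'' (var ''a'')))
    (Seq (Assign ''q'' (Num 0) (Plus (var ''q'') (Num 1)))
    (Seq (Assign ''a'' (Num 0) (Num 0))
    (Seq (Assign ''b'' (Num 0) (Num 0))
         (PreOp (Reg ''T'' (Num 0)) (Reg ''B'' (Num 0))))))))))"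

text \<open>A single loop over splitter \<open>b\<close> and class \<open>a\<close> instead of two
  nested ones: restarting is then a mere assignment and the body is loop-free. \<open>T\<close>
  caches the predecessors of the splitter, so a pass over all classes costs one one-step
  operation.\<close>

definition refine_body :: com where
  "refine_body =
     Cond (Less (var ''a'') (var ''q''))
       (Seq (SetOp (Reg ''D'' (Num 0)) SInter (Reg ''B'' (var ''a'')) (Reg ''T'' (Num 0)))
       (Seq (SetTest ''t'' (Num 0) SEqual (Reg ''D'' (Num 0)) (Reg ''Z'' (Num 0)))
       (Seq (SetTest ''u'' (Num 0) SEqual (Reg ''D'' (Num 0)) (Reg ''B'' (var ''a'')))
            (Cond (Conj (Eq (var ''t'') (Num 0)) (Eq (var ''u'') (Num 0)))
              split_class
              (Seq (Assign ''M'' (edge_cell ''a'' ''b'') (var ''u''))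
                   (Assign ''a'' (Num 0) (Plus (var ''a'') (Num 1))))))))
       (Seq (Assign ''b'' (Num 0) (Plus (var ''b'') (Num 1)))
       (Seq (Assign ''a'' (Num 0) (Num 0))
            (PreOp (Reg ''T'' (Num 0)) (Reg ''B'' (var ''b'')))))"

definition refine_prog :: com where
  "refine_prog =
     Seq (PreOp (Reg ''T'' (Num 0)) (Reg ''B'' (Num 0)))
         (While (Less (var ''b'') (var ''q'')) refine_body)"

definition check_body :: com where
  "check_body =
     Seq (Cond (Eq (Cell ''M'' (edge_cell ''x'' ''y'')) (Num 1))
           (Cond (Less (Cell ''r'' (var ''y''))
                    (Plus (Cell ''r'' (var ''x'')) (Cell ''e'' (var ''x''))))
             (Cond (Eq (Cell ''o'' (var ''x'')) (Num 0)) Skip (Assign ''g'' (Num 0) (Num 1)))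
             (Cond (Eq (Cell ''o'' (var ''x'')) (Num 0)) (Assign ''g'' (Num 0) (Num 0)) Skip))
           Skip)
         (Assign ''y'' (Num 0) (Plus (var ''y'') (Num 1)))"

text \<open>The start value is \<open>lifted\<close> over no successors: true for a class of Odd,
  false for one of Even.\<close>

definition check_init :: com where
  "check_init =
     Seq (Assign ''g'' (Num 0) (Minus (Num 1) (Cell ''o'' (var ''x''))))
         (Assign ''y'' (Num 0) (Num 0))"

text \<open>Raising a rank can invalidate classes already passed, so \<open>x\<close> returns to 0.
  Ranks that have reached the top are left alone.\<close>

definition lift_step :: com where
  "lift_step =
     Cond (Conj (Eq (var ''g'') (Num 0)) (Less (Cell ''r'' (var ''x'')) (var ''w'')))
       (Seq (Assign ''r'' (var ''x'') (Plus (Cell ''r'' (var ''x'')) (Cell ''d'' (var ''x''))))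
            (Assign ''x'' (Num 0) (Num 0)))
       (Assign ''x'' (Num 0) (Plus (var ''x'') (Num 1)))"

definition lift_prog :: com where
  "lift_prog =
     While (Less (var ''x'') (var ''q''))
       (Seq check_init
       (Seq (While (Less (var ''y'') (var ''q'')) check_body)
            lift_step))"

definition output_body :: com where
  "output_body =
     Seq (Cond (Less (Cell ''r'' (var ''z'')) (var ''w''))
           (SetOp (Reg ''WE'' (Num 0)) SUnion (Reg ''WE'' (Num 0)) (Reg ''B'' (var ''z'')))
           (SetOp (Reg ''WO'' (Num 0)) SUnion (Reg ''WO'' (Num 0)) (Reg ''B'' (var ''z''))))
         (Assign ''z'' (Num 0) (Plus (var ''z'') (Num 1)))"

definition output_prog :: com where
  "output_prog = While (Less (var ''z'') (var ''q'')) output_body"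

definition parity_prog :: com where
  "parity_prog = Seq init_prog (Seq refine_prog (Seq lift_prog output_prog))"

section \<open>Register budget\<close>

definition regs_bound :: "nat \<Rightarrow> nat \<Rightarrow> (vname \<times> nat) set" where
  "regs_bound n c = input_regs c \<union> {''B''} \<times> {..n} \<union>
     {(''Z'', 0), (''T'', 0), (''D'', 0), (''WE'', 0), (''WO'', 0)}"

lemma input_regs_subset: "input_regs c \<subseteq> regs_bound n c"
  unfolding regs_bound_def by blast

lemma regs_bound_mem [simp]:
  "(''VE'', 0) \<in> regs_bound n c" "(''VO'', 0) \<in> regs_bound n c"
  "i < c \<Longrightarrow> (''P'', i) \<in> regs_bound n c"
  "i \<le> n \<Longrightarrow> (''B'', i) \<in> regs_bound n c" "(''Z'', 0) \<in> regs_bound n c"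
  "(''T'', 0) \<in> regs_bound n c" "(''D'', 0) \<in> regs_bound n c"
  "(''WE'', 0) \<in> regs_bound n c" "(''WO'', 0) \<in> regs_bound n c"
  unfolding regs_bound_def input_regs_def by auto

lemma card_regs_bound: "card (regs_bound n c) \<le> n + c + 8"
proof -
  have P: "{(''P'', i) | i. i < c} = Pair ''P'' ` {..<c}" by auto
  have "card {(''P'', i) | i. i < c} \<le> c"
    unfolding P using card_image_le[of "{..<c}" "Pair ''P''"] by simp
  moreover have "card {(''VE'', 0 :: nat), (''VO'', 0)} \<le> 2"
    by (simp add: card_insert_if)
  moreover have "card (input_regs c) \<le>
      card {(''VE'', 0 :: nat), (''VO'', 0)} + card {(''P'', i) | i. i < c}"
    unfolding input_regs_def by (rule card_Un_le)
  moreover have "card ({''B''} \<times> {..n}) \<le> n + 1"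
    by (simp add: card_cartesian_product)
  moreover have "card {(''Z'', 0 :: nat), (''T'', 0), (''D'', 0), (''WE'', 0), (''WO'', 0)} \<le> 5"
    by (simp add: card_insert_if)
  moreover have "card (regs_bound n c) \<le> card (input_regs c) + card ({''B''} \<times> {..n}) +
      card {(''Z'', 0 :: nat), (''T'', 0), (''D'', 0), (''WE'', 0), (''WO'', 0)}"
    unfolding regs_bound_def by (meson card_Un_le order_trans add_le_mono1)
  ultimately show ?thesis by linarith
qed

text \<open>Lifting and output do not reset \<open>r\<close>, \<open>x\<close>, \<open>z\<close>,
  \<open>WE\<close> and \<open>WO\<close>; they rely on the initial zeros and empty sets, which are
  therefore carried through the earlier phases.\<close>

definition base_inv :: "'v game \<Rightarrow> nat \<Rightarrow> 'v state \<Rightarrow> bool" where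
  "base_inv G c s \<longleftrightarrow>
     nums s ''n'' 0 = card (verts G) \<and> nums s ''c'' 0 = c \<and>
     regs s (''Z'', 0) = {} \<and> regs s (''VE'', 0) = owned G Even \<and> regs s (''VO'', 0) = owned G Odd \<and>
     (\<forall>i<c. regs s (''P'', i) = prio_class G i) \<and>
     regs s (''WE'', 0) = {} \<and> regs s (''WO'', 0) = {} \<and> nums s ''r'' = (\<lambda>_. 0) \<and>
     nums s ''x'' 0 = 0 \<and> nums s ''z'' 0 = 0 \<and>
     used s \<subseteq> regs_bound (card (verts G)) c"

definition state_classes :: "'v game \<Rightarrow> 'v set \<Rightarrow> 'v state \<Rightarrow> bool" where
  "state_classes G S s \<longleftrightarrow>
     classes G (Suc (card (verts G))) S (nums s ''q'' 0) (\<lambda>a. regs s (''B'', a))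
       (nums s ''d'') (nums s ''e'') (nums s ''o'')"

lemma classes_cong:
  assumes "classes G b S q B d e w" "\<And>a. a < q \<Longrightarrow> B' a = B a"
  shows "classes G b S q B' d e w"
  using assms unfolding classes_def by simp

section \<open>Initial partition by priority and owner\<close>

lemma add_class_run:
  assumes base: "base_inv G c s" and G: "game_graph G"
    and X: "X = ''VE'' \<or> X = ''VO''"
    and N: "N = prio_class G (nums s ''i'' 0) \<inter> regs s (X, 0)"
    and cl: "state_classes G S s" and S: "S \<subseteq> verts G" "N \<inter> S = {}" and i: "nums s ''i'' 0 < c"
    and attr: "class_attrs G (Suc (card (verts G))) N (nums s ''w'' 0)
      (nums s ''m'' 0 * nums s ''w'' 0) f"
    and t: "t = run G (add_class X f) s"
  shows "base_inv G c t \<and> state_classes G (S \<union> N) t \<and> one_steps t = one_steps s \<and>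
    set_ops t = set_ops s + 2 \<and> (\<forall>x\<in>{''i'', ''w'', ''m'', ''a'', ''b''}. nums t x = nums s x)"
proof -
  let ?n = "card (verts G)" and ?q = "nums s ''q'' 0"
  have fin: "finite (verts G)" using G unfolding game_graph_def by simp
  have q: "?q \<le> ?n"
    using classes_card_le[OF cl[unfolded state_classes_def]] card_mono[OF fin S(1)]
      finite_subset[OF S(1) fin] by simp
  have cl': "classes G (Suc ?n) (S \<union> N) (Suc ?q) ((\<lambda>a. regs s (''B'', a))(?q := N))
      ((nums s ''d'')(?q := nums s ''w'' 0)) ((nums s ''e'')(?q := nums s ''m'' 0 * nums s ''w'' 0))
      ((nums s ''o'')(?q := f))" if "N \<noteq> {}"
    by (rule classes_add[OF cl[unfolded state_classes_def] that S(2) attr])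
  \<comment> \<open>An empty intersection still overwrites register \<open>q\<close>, which lies
    just beyond the classes.\<close>
  have cl'': "classes G (Suc ?n) S ?q (\<lambda>a. if a = ?q then {} else regs s (''B'', a))
      (nums s ''d'') (nums s ''e'') (nums s ''o'')"
    by (rule classes_cong[OF cl[unfolded state_classes_def]]) simp
  have regX: "(X, 0) \<in> regs_bound ?n c" using X by auto
  have P: "regs s (''P'', nums s ''i'' 0) = prio_class G (nums s ''i'' 0)"
    using base i unfolding base_inv_def by blast
  show ?thesis
  proof (cases "N = {}")
    case True
    then show ?thesis
      using base cl'' q i X regX P N unfolding t add_class_def base_inv_def state_classes_def
      by (auto simp: step_simps)
  next
    case False
    then show ?thesis
      using base cl'[OF False] q i X regX P N
      unfolding t add_class_def base_inv_def state_classes_def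
      by (auto simp: step_simps fun_upd_def)
  qed
qed

lemma initial_state_base:
  "base_inv G c (initial_state G c)"
  unfolding base_inv_def initial_state_def using input_regs_subset by (auto simp: fun_eq_iff)

text \<open>Four set operations per priority: an intersection and an emptiness test for each
  owner.\<close>

definition init_inv :: "'v game \<Rightarrow> nat \<Rightarrow> 'v state \<Rightarrow> bool" where
  "init_inv G c s \<longleftrightarrow>
     base_inv G c s \<and> nums s ''i'' 0 \<le> c \<and>
     state_classes G {v \<in> verts G. prio G v < nums s ''i'' 0} s \<and>
     nums s ''w'' 0 = Suc (card (verts G)) ^ nums s ''i'' 0 \<and>
     nums s ''m'' 0 = of_bool (even (nums s ''i'' 0)) \<and>
     nums s ''a'' 0 = 0 \<and> nums s ''b'' 0 = 0 \<and>
     one_steps s = 0 \<and> set_ops s = 4 * nums s ''i'' 0"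

lemma init_body_run:
  assumes G: "game_graph G" and inv: "init_inv G c s" and i: "nums s ''i'' 0 < c"
    and t: "t = run G init_body s"
  shows "init_inv G c t \<and> nums t ''i'' 0 = Suc (nums s ''i'' 0)"
proof -
  let ?i = "nums s ''i'' 0" and ?b = "Suc (card (verts G))"
  define s1 where "s1 = run G (add_class ''VE'' 1) s"
  define s2 where "s2 = run G (add_class ''VO'' 0) s1"
  let ?S = "{v \<in> verts G. prio G v < ?i}"
  let ?E = "prio_class G ?i \<inter> owned G Even" and ?O = "prio_class G ?i \<inter> owned G Odd"
  have own: "owned G Even \<union> owned G Odd = verts G" "owned G Even \<inter> owned G Odd = {}"
    using G unfolding game_graph_def by auto
  have base: "base_inv G c s" and cl: "state_classes G ?S s" and w: "nums s ''w'' 0 = ?b ^ ?i"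
    and m: "nums s ''m'' 0 = of_bool (even ?i)"
    using inv unfolding init_inv_def by auto
  have VE: "regs s (''VE'', 0) = owned G Even" using base unfolding base_inv_def by simp
  have s1: "base_inv G c s1 \<and> state_classes G (?S \<union> ?E) s1 \<and> one_steps s1 = one_steps s \<and>
      set_ops s1 = set_ops s + 2 \<and> (\<forall>x\<in>{''i'', ''w'', ''m'', ''a'', ''b''}. nums s1 x = nums s x)"
    using own i by (intro add_class_run[OF base G _ _ cl _ _ _ _ s1_def])
      (auto simp: VE prio_class_def class_attrs_def w m)
  then have b1: "base_inv G c s1" and c1: "state_classes G (?S \<union> ?E) s1"
    and n1: "nums s1 ''i'' = nums s ''i''" "nums s1 ''w'' = nums s ''w''"
      "nums s1 ''m'' = nums s ''m''" by auto
  have VO: "regs s1 (''VO'', 0) = owned G Odd" using b1 unfolding base_inv_def by simp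
  have s2: "base_inv G c s2 \<and> state_classes G (?S \<union> ?E \<union> ?O) s2 \<and> one_steps s2 = one_steps s1 \<and>
      set_ops s2 = set_ops s1 + 2 \<and> (\<forall>x\<in>{''i'', ''w'', ''m'', ''a'', ''b''}. nums s2 x = nums s1 x)"
    using own i by (intro add_class_run[OF b1 G _ _ c1 _ _ _ _ s2_def])
      (auto simp: VO prio_class_def class_attrs_def w m n1)
  have t': "t = s2\<lparr>nums := (nums s2)(''w'' := (nums s2 ''w'')(0 := nums s2 ''w'' 0 * (nums s2 ''n'' 0 + 1)),
      ''m'' := (nums s2 ''m'')(0 := 1 - nums s2 ''m'' 0), ''i'' := (nums s2 ''i'')(0 := nums s2 ''i'' 0 + 1))\<rparr>"
    unfolding t init_body_def s2_def s1_def by (simp add: step_simps)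
  have S: "?S \<union> ?E \<union> ?O = {v \<in> verts G. prio G v < Suc ?i}"
    using own by (auto simp: prio_class_def less_Suc_eq)
  show ?thesis
    using s2 s1 inv i unfolding t' init_inv_def S base_inv_def state_classes_def
    by simp
qed

lemma init_prog_total:
  assumes G: "game_graph G" and c: "\<And>v. v \<in> verts G \<Longrightarrow> prio G v < c"
  shows "\<exists>t. exec G init_prog (initial_state G c) t \<and> base_inv G c t \<and> state_classes G (verts G) t \<and>
    nums t ''w'' 0 = Suc (card (verts G)) ^ c \<and> nums t ''a'' 0 = 0 \<and> nums t ''b'' 0 = 0 \<and>
    one_steps t = 0 \<and> set_ops t = 4 * c"
proof -
  let ?s = "run G (Assign ''m'' (Num 0) (Num 1)) (run G (Assign ''w'' (Num 0) (Num 1)) (initial_state G c))"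
  have init: "init_inv G c ?s"
    using initial_state_base[of G c]
    unfolding init_inv_def base_inv_def state_classes_def classes_def
    by (simp add: step_simps) (simp add: initial_state_def)
  have "\<exists>t. exec G (While (Less (var ''i'') (var ''c'')) init_body) ?s t \<and> init_inv G c t \<and>
      \<not> bval (Less (var ''i'') (var ''c'')) (nums t)"
  proof (rule exec_While_total[where I = "init_inv G c" and \<mu> = "\<lambda>s. c - nums s ''i'' 0", OF _ init])
    fix s :: "'a state"
    assume inv: "init_inv G c s" and b: "bval (Less (var ''i'') (var ''c'')) (nums s)"
    have i: "nums s ''i'' 0 < c"
      using inv b unfolding init_inv_def base_inv_def by simp
    have "loop_free init_body"
      unfolding init_body_def add_class_def by simp
    then show "\<exists>t. exec G init_body s t \<and> init_inv G c t \<and> c - nums t ''i'' 0 < c - nums s ''i'' 0"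
      using exec_run[of init_body G s] init_body_run[OF G inv i refl] i by auto
  qed
  then obtain t where t: "exec G (While (Less (var ''i'') (var ''c'')) init_body) ?s t"
    "init_inv G c t" "\<not> nums t ''i'' 0 < nums t ''c'' 0" by auto
  have "exec G init_prog (initial_state G c) t"
    unfolding init_prog_def by (rule exec.Seq[OF exec_run exec.Seq[OF exec_run t(1)]]) simp_all
  moreover have "nums t ''i'' 0 = c"
    using t(2,3) unfolding init_inv_def base_inv_def by auto
  moreover have "{v \<in> verts G. prio G v < c} = verts G"
    using c by blast
  ultimately show ?thesis
    using t(2) unfolding init_inv_def by auto
qed

section \<open>Partition refinement\<close>

definition edge_rel :: "'v game \<Rightarrow> 'v state \<Rightarrow> nat \<Rightarrow> nat \<Rightarrow> bool" where
  "edge_rel G s a a' \<longleftrightarrow> nums s ''M'' (a * card (verts G) + a') = 1"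

text \<open>The triple of \<open>q\<close>, \<open>b\<close>, \<open>a\<close> read
  lexicographically in base \<open>n + 2\<close>. It grows in each iteration, so it yields
  termination and also serves as the clock that bounds the set operations.\<close>

definition refine_pos :: "'v game \<Rightarrow> 'v state \<Rightarrow> nat" where
  "refine_pos G s =
     nums s ''q'' 0 * (card (verts G) + 2) ^ 2 + nums s ''b'' 0 * (card (verts G) + 2) + nums s ''a'' 0"

text \<open>The factor 5 is the worst iteration: an intersection and two tests, then two operations
  for a split. One-step operations occur once initially, once per new splitter and once per split; a
  split raises the bound by \<open>n + 2\<close> minus the discarded \<open>b\<close>, which is
  positive.\<close>

definition refine_inv :: "'v game \<Rightarrow> nat \<Rightarrow> 'v state \<Rightarrow> bool" where
  "refine_inv G c s \<longleftrightarrow>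
     base_inv G c s \<and> state_classes G (verts G) s \<and>
     nums s ''w'' 0 = Suc (card (verts G)) ^ c \<and>
     nums s ''a'' 0 \<le> nums s ''q'' 0 \<and> nums s ''b'' 0 \<le> nums s ''q'' 0 \<and>
     regs s (''T'', 0) = pre G (regs s (''B'', nums s ''b'' 0)) \<and>
     (\<forall>a<nums s ''q'' 0. \<forall>a'<nums s ''q'' 0.
        a' < nums s ''b'' 0 \<or> a' = nums s ''b'' 0 \<and> a < nums s ''a'' 0 \<longrightarrow>
        regs s (''B'', a) \<inter> pre G (regs s (''B'', a')) =
          (if edge_rel G s a a' then regs s (''B'', a) else {})) \<and>
     one_steps s \<le> nums s ''q'' 0 * (card (verts G) + 2) + nums s ''b'' 0 + 1 \<and>
     set_ops s \<le> 4 * c + 5 * refine_pos G s"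

lemma state_classes_card_le:
  assumes "game_graph G" "state_classes G (verts G) s"
  shows "nums s ''q'' 0 \<le> card (verts G)"
  using classes_card_le[OF assms(2)[unfolded state_classes_def]] assms(1)
  unfolding game_graph_def by blast

text \<open>Makes the addressing of edge cells injective, as class indices are below
  \<open>n\<close>.\<close>

lemma mult_add_eq_iff:
  fixes a a' i i' n :: nat
  assumes "i < n" "i' < n"
  shows "a * n + i = a' * n + i' \<longleftrightarrow> a = a' \<and> i = i'"
proof
  assume eq: "a * n + i = a' * n + i'"
  then have "(a * n + i) div n = (a' * n + i') div n" by simp
  then have "a = a'" using assms by simp
  then show "a = a' \<and> i = i'" using eq by simp
qed simp

lemma refine_advance_splitter:
  assumes G: "game_graph G" and inv: "refine_inv G c s"
    and b: "nums s ''b'' 0 < nums s ''q'' 0" and a: "\<not> nums s ''a'' 0 < nums s ''q'' 0"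
    and t: "t = run G refine_body s"
  shows "refine_inv G c t \<and> refine_pos G s < refine_pos G t"
proof -
  have q: "nums s ''q'' 0 \<le> card (verts G)"
    using state_classes_card_le[OF G] inv unfolding refine_inv_def by blast
  have a': "nums s ''a'' 0 = nums s ''q'' 0"
    using inv a unfolding refine_inv_def by simp
  have t': "t = s\<lparr>nums := (nums s)(''b'' := (nums s ''b'')(0 := Suc (nums s ''b'' 0)),
      ''a'' := (nums s ''a'')(0 := 0)),
      regs := (regs s)((''T'', 0) := pre G (regs s (''B'', Suc (nums s ''b'' 0)))),
      one_steps := Suc (one_steps s),
      used := used s \<union> {(''T'', 0), (''B'', Suc (nums s ''b'' 0))}\<rparr>"
    unfolding t refine_body_def using a by (simp add: step_simps)
  have pos: "refine_pos G s < refine_pos G t"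
    using q a' unfolding refine_pos_def t' by simp
  moreover have "refine_inv G c t"
    using inv pos b a' q
    unfolding refine_inv_def base_inv_def state_classes_def edge_rel_def
    by (simp add: t' less_Suc_eq)
  ultimately show ?thesis by blast
qed

lemma refine_advance_class:
  assumes G: "game_graph G" and inv: "refine_inv G c s"
    and b: "nums s ''b'' 0 < nums s ''q'' 0" and a: "nums s ''a'' 0 < nums s ''q'' 0"
    and D: "D = regs s (''B'', nums s ''a'' 0) \<inter> regs s (''T'', 0)"
      "D = {} \<or> D = regs s (''B'', nums s ''a'' 0)"
    and t: "t = run G refine_body s"
  shows "refine_inv G c t \<and> refine_pos G s < refine_pos G t"
proof -
  let ?n = "card (verts G)" and ?a = "nums s ''a'' 0" and ?b = "nums s ''b'' 0"
  have q: "nums s ''q'' 0 \<le> ?n"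
    using state_classes_card_le[OF G] inv unfolding refine_inv_def by blast
  have n: "nums s ''n'' 0 = ?n" and Z: "regs s (''Z'', 0) = {}"
    using inv unfolding refine_inv_def base_inv_def by auto
  have t': "nums t = (nums s)(''t'' := (nums s ''t'')(0 := of_bool (D = {})),
      ''u'' := (nums s ''u'')(0 := of_bool (D = regs s (''B'', ?a))),
      ''M'' := (nums s ''M'')(?a * ?n + ?b := of_bool (D = regs s (''B'', ?a))),
      ''a'' := (nums s ''a'')(0 := Suc ?a))"
    "regs t = (regs s)((''D'', 0) := D)" "set_ops t = set_ops s + 3" "one_steps t = one_steps s"
    "used t = used s \<union> {(''D'', 0), (''B'', ?a), (''T'', 0), (''Z'', 0)}"
    unfolding t refine_body_def edge_cell_def using a D n Z
    by (auto simp: step_simps)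
  have pos: "refine_pos G t = Suc (refine_pos G s)"
    unfolding refine_pos_def t' by simp
  have nonempty: "regs s (''B'', ?a) \<noteq> {}"
    using inv a unfolding refine_inv_def state_classes_def classes_def by blast
  have M: "edge_rel G t a a' = (if a = ?a \<and> a' = ?b then D = regs s (''B'', ?a) else edge_rel G s a a')"
    if "a' < nums s ''q'' 0" for a a'
    using mult_add_eq_iff[of a' ?n ?b a ?a] that b q unfolding edge_rel_def t' by auto
  have T: "regs s (''T'', 0) = pre G (regs s (''B'', ?b))"
    using inv unfolding refine_inv_def by blast
  have "regs t (''B'', a) \<inter> pre G (regs t (''B'', a')) = (if edge_rel G t a a' then regs t (''B'', a) else {})"
    if "a < nums t ''q'' 0" "a' < nums t ''q'' 0" "a' < nums t ''b'' 0 \<or> a' = nums t ''b'' 0 \<and> a < nums t ''a'' 0"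
    for a a'
  proof (cases "a = ?a \<and> a' = ?b")
    case True
    then show ?thesis
      using M[of a' a] that D T nonempty unfolding t' by auto
  next
    case False
    then have "a' < ?b \<or> a' = ?b \<and> a < ?a" "a < nums s ''q'' 0" "a' < nums s ''q'' 0"
      using that unfolding t' by auto
    then have "regs s (''B'', a) \<inter> pre G (regs s (''B'', a')) =
        (if edge_rel G s a a' then regs s (''B'', a) else {})"
      using inv unfolding refine_inv_def by blast
    then show ?thesis
      using M[of a' a] False \<open>a' < nums s ''q'' 0\<close> unfolding t' by simp
  qed
  then have "refine_inv G c t"
    using inv pos a q
    unfolding refine_inv_def base_inv_def state_classes_def
    by (simp add: t')
  then show ?thesis using pos by simp
qed

lemma refine_split:
  assumes G: "game_graph G" and inv: "refine_inv G c s"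
    and b: "nums s ''b'' 0 < nums s ''q'' 0" and a: "nums s ''a'' 0 < nums s ''q'' 0"
    and D: "D = regs s (''B'', nums s ''a'' 0) \<inter> regs s (''T'', 0)"
      "D \<noteq> {}" "D \<noteq> regs s (''B'', nums s ''a'' 0)"
    and t: "t = run G refine_body s"
  shows "refine_inv G c t \<and> refine_pos G s < refine_pos G t"
proof -
  let ?n = "card (verts G)" and ?a = "nums s ''a'' 0" and ?b = "nums s ''b'' 0" and ?q = "nums s ''q'' 0"
  have n: "nums s ''n'' 0 = ?n" and Z: "regs s (''Z'', 0) = {}"
    using inv unfolding refine_inv_def base_inv_def by auto
  have q0: "?q \<le> ?n"
    using state_classes_card_le[OF G] inv unfolding refine_inv_def by blast
  let ?R = "(regs s)((''D'', 0) := D, (''B'', ?q) := D, (''B'', ?a) := regs s (''B'', ?a) - D)"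
  have t': "nums t = (nums s)(''t'' := (nums s ''t'')(0 := 0),
      ''u'' := (nums s ''u'')(0 := 0),
      ''d'' := (nums s ''d'')(?q := nums s ''d'' ?a),
      ''e'' := (nums s ''e'')(?q := nums s ''e'' ?a),
      ''o'' := (nums s ''o'')(?q := nums s ''o'' ?a),
      ''q'' := (nums s ''q'')(0 := Suc ?q),
      ''a'' := (nums s ''a'')(0 := 0), ''b'' := (nums s ''b'')(0 := 0))"
    "regs t = ?R((''T'', 0) := pre G (?R (''B'', 0)))" "set_ops t = set_ops s + 5"
    "one_steps t = Suc (one_steps s)"
    "used t = used s \<union> {(''D'', 0), (''B'', ?a), (''T'', 0), (''Z'', 0), (''B'', ?q), (''B'', 0)}"
    unfolding t refine_body_def split_class_def using a D n Z
    by (auto simp: step_simps)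
  have "classes G (Suc ?n) (verts G) (Suc ?q) ((\<lambda>a. regs s (''B'', a))(?a := regs s (''B'', ?a) - D, ?q := D))
      ((nums s ''d'')(?q := nums s ''d'' ?a)) ((nums s ''e'')(?q := nums s ''e'' ?a))
      ((nums s ''o'')(?q := nums s ''o'' ?a))"
    using inv a D unfolding refine_inv_def state_classes_def
    by (intro classes_split) auto
  also have "(\<lambda>a. regs s (''B'', a))(?a := regs s (''B'', ?a) - D, ?q := D) = (\<lambda>a. regs t (''B'', a))"
    using a unfolding t' by (auto simp: fun_eq_iff)
  finally have cl: "state_classes G (verts G) t"
    unfolding state_classes_def by (simp add: t' fun_upd_def)
  \<comment> \<open>Both halves are nonempty, so the enlarged partition obeys the bound as well;
    this keeps \<open>q\<close> within the register budget.\<close>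
  have q: "Suc ?q \<le> ?n"
    using state_classes_card_le[OF G cl] by (simp add: t')
  \<comment> \<open>The two reset digits are worth less than \<open>(?n + 2) ^ 2\<close>, the gain
    of the leading one.\<close>
  have "?b * (?n + 2) + ?a < (?n + 1) * (?n + 2) + (?n + 2)"
    using b a q by (intro add_le_less_mono mult_le_mono) auto
  then have pos: "refine_pos G s < refine_pos G t"
    unfolding refine_pos_def t' by (simp add: power2_eq_square algebra_simps)
  moreover have "refine_inv G c t"
    using inv pos a b q cl
    unfolding refine_inv_def base_inv_def by (simp add: t')
  ultimately show ?thesis by simp
qed

lemma refine_prog_total:
  assumes G: "game_graph G"
    and s: "base_inv G c s" "state_classes G (verts G) s" "nums s ''w'' 0 = Suc (card (verts G)) ^ c"
      "nums s ''a'' 0 = 0" "nums s ''b'' 0 = 0" "one_steps s = 0" "set_ops s = 4 * c"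
  shows "\<exists>t. exec G refine_prog s t \<and> refine_inv G c t \<and>
    stable_edges G (nums t ''q'' 0) (\<lambda>a. regs t (''B'', a)) (edge_rel G t)"
proof -
  let ?s = "run G (PreOp (Reg ''T'' (Num 0)) (Reg ''B'' (Num 0))) s"
  let ?n = "card (verts G)"
  have init: "refine_inv G c ?s"
    using s unfolding refine_inv_def base_inv_def state_classes_def by (simp add: step_simps)
  \<comment> \<open>The largest possible position, all three components being at most
    \<open>?n\<close>; it turns the growing position into a decreasing variant.\<close>
  define K where "K = ?n * (?n + 2) ^ 2 + ?n * (?n + 2) + ?n"
  have K: "refine_pos G s \<le> K" if "refine_inv G c s" for s
  proof -
    have "nums s ''q'' 0 \<le> ?n"
      using state_classes_card_le[OF G] that unfolding refine_inv_def by blast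
    then show ?thesis
      using that unfolding refine_pos_def K_def refine_inv_def
      by (intro add_mono mult_le_mono) auto
  qed
  have "\<exists>t. exec G (While (Less (var ''b'') (var ''q'')) refine_body) ?s t \<and> refine_inv G c t \<and>
      \<not> bval (Less (var ''b'') (var ''q'')) (nums t)"
  proof (rule exec_While_total[where I = "refine_inv G c" and \<mu> = "\<lambda>s. K - refine_pos G s", OF _ init])
    fix s :: "'a state"
    assume inv: "refine_inv G c s" and b: "bval (Less (var ''b'') (var ''q'')) (nums s)"
    have "loop_free refine_body"
      unfolding refine_body_def split_class_def by simp
    moreover have step: "refine_inv G c (run G refine_body s) \<and>
        refine_pos G s < refine_pos G (run G refine_body s)"
    proof -
      have b': "nums s ''b'' 0 < nums s ''q'' 0" using b by simp
      let ?D = "regs s (''B'', nums s ''a'' 0) \<inter> regs s (''T'', 0)"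
      consider "\<not> nums s ''a'' 0 < nums s ''q'' 0"
        | "nums s ''a'' 0 < nums s ''q'' 0" "?D = {} \<or> ?D = regs s (''B'', nums s ''a'' 0)"
        | "nums s ''a'' 0 < nums s ''q'' 0" "?D \<noteq> {}" "?D \<noteq> regs s (''B'', nums s ''a'' 0)"
        by blast
      then show ?thesis
      proof cases
        case 1
        then show ?thesis by (rule refine_advance_splitter[OF G inv b' _ refl])
      next
        case 2
        then show ?thesis by (rule refine_advance_class[OF G inv b' _ refl _ refl])
      next
        case 3
        then show ?thesis by (rule refine_split[OF G inv b' _ refl _ _ refl])
      qed
    qed
    ultimately show "\<exists>t. exec G refine_body s t \<and> refine_inv G c t \<and>
        K - refine_pos G t < K - refine_pos G s"
      using exec_run[of refine_body G s] K[of "run G refine_body s"] 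
      by (intro exI[of _ "run G refine_body s"]) auto
  qed
  then obtain t where t: "exec G (While (Less (var ''b'') (var ''q'')) refine_body) ?s t"
    "refine_inv G c t" "\<not> nums t ''b'' 0 < nums t ''q'' 0" by auto
  have "exec G refine_prog s t"
    unfolding refine_prog_def by (rule exec.Seq[OF exec_run t(1)]) simp
  moreover have "stable_edges G (nums t ''q'' 0) (\<lambda>a. regs t (''B'', a)) (edge_rel G t)"
    using t(2,3) unfolding refine_inv_def stable_edges_def by auto
  ultimately show ?thesis using t(2) by blast
qed

section \<open>The lifting loop\<close>

definition lift_frame :: "'v state \<Rightarrow> 'v state \<Rightarrow> bool" where
  "lift_frame s t \<longleftrightarrow>
     regs t = regs s \<and> one_steps t = one_steps s \<and> set_ops t = set_ops s \<and> used t = used s \<and>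
     (\<forall>x\<in>{''n'', ''q'', ''d'', ''e'', ''o'', ''w'', ''M'', ''z''}. nums t x = nums s x)"

lemma lift_frame_trans:
  "lift_frame s t \<Longrightarrow> lift_frame t u \<Longrightarrow> lift_frame s u"
  unfolding lift_frame_def by simp

lemma lifted_0: "lifted 0 E e w r a \<longleftrightarrow> w a = 0"
  unfolding lifted_def by simp

text \<open>Follows the branching of \<open>check_body\<close>, so that \<open>g\<close> holds the
  value over the first \<open>y\<close> classes.\<close>

lemma lifted_Suc:
  "lifted (Suc y) E e w r a \<longleftrightarrow>
     (if E a y then
        if r y < r a + e a then (if w a = 0 then lifted y E e w r a else True)
        else (if w a = 0 then False else lifted y E e w r a)
      else lifted y E e w r a)"
  unfolding lifted_def by (auto simp: less_Suc_eq)

lemma check_total: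
  assumes n: "nums s ''n'' 0 = card (verts G)"
  shows "\<exists>t. exec G (Seq check_init (While (Less (var ''y'') (var ''q'')) check_body)) s t \<and>
    lift_frame s t \<and> nums t ''x'' = nums s ''x'' \<and> nums t ''r'' = nums s ''r'' \<and>
    nums t ''g'' 0 = of_bool (lifted (nums s ''q'' 0) (edge_rel G s) (nums s ''e'') (nums s ''o'')
      (nums s ''r'') (nums s ''x'' 0))"
proof -
  define L where "L y \<longleftrightarrow> lifted y (edge_rel G s) (nums s ''e'') (nums s ''o'')
      (nums s ''r'') (nums s ''x'' 0)" for y
  define I where "I t \<longleftrightarrow> lift_frame s t \<and> nums t ''x'' = nums s ''x'' \<and> nums t ''r'' = nums s ''r'' \<and>
      nums t ''y'' 0 \<le> nums s ''q'' 0 \<and> nums t ''g'' 0 = of_bool (L (nums t ''y'' 0))" for t :: "'a state"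
  have init: "I (run G check_init s)"
    unfolding I_def L_def lift_frame_def check_init_def by (simp add: step_simps lifted_0)
  have "\<exists>t. exec G (While (Less (var ''y'') (var ''q'')) check_body) (run G check_init s) t \<and> I t \<and>
      \<not> bval (Less (var ''y'') (var ''q'')) (nums t)"
  proof (rule exec_While_total[where I = I and \<mu> = "\<lambda>t. nums s ''q'' 0 - nums t ''y'' 0", OF _ init])
    fix t :: "'a state"
    assume inv: "I t" and b: "bval (Less (var ''y'') (var ''q'')) (nums t)"
    have y: "nums t ''y'' 0 < nums s ''q'' 0"
      using inv b unfolding I_def lift_frame_def by simp
    let ?t = "run G check_body t"
    have nums: "nums t ''n'' = nums s ''n''" "nums t ''q'' = nums s ''q''" "nums t ''e'' = nums s ''e''"
        "nums t ''o'' = nums s ''o''" "nums t ''M'' = nums s ''M''"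
        "nums t ''x'' = nums s ''x''" "nums t ''r'' = nums s ''r''"
        "nums t ''g'' 0 = of_bool (L (nums t ''y'' 0))"
      using inv unfolding I_def lift_frame_def by auto
    have y': "nums ?t ''y'' 0 = Suc (nums t ''y'' 0)"
      unfolding check_body_def by (simp add: step_simps)
    have g': "nums ?t ''g'' 0 = of_bool (L (Suc (nums t ''y'' 0)))"
      unfolding check_body_def L_def lifted_Suc edge_cell_def
      using nums n unfolding L_def edge_rel_def by (simp add: step_simps)
    have "lift_frame t ?t" "nums ?t ''x'' = nums t ''x''" "nums ?t ''r'' = nums t ''r''"
      unfolding lift_frame_def check_body_def by (simp_all add: step_simps)
    then have "I ?t"
      using inv y y' g' lift_frame_trans unfolding I_def by auto
    moreover have "loop_free check_body"
      unfolding check_body_def by simp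
    ultimately show "\<exists>t'. exec G check_body t t' \<and> I t' \<and>
        nums s ''q'' 0 - nums t' ''y'' 0 < nums s ''q'' 0 - nums t ''y'' 0"
      using exec_run[of check_body G t] y y' by (intro exI[of _ ?t]) auto
  qed
  then obtain t where t: "exec G (While (Less (var ''y'') (var ''q'')) check_body) (run G check_init s) t"
    "I t" "\<not> nums t ''y'' 0 < nums t ''q'' 0" by auto
  have "exec G (Seq check_init (While (Less (var ''y'') (var ''q'')) check_body)) s t"
    by (rule exec.Seq[OF exec_run t(1)]) (simp add: check_init_def)
  moreover have "nums t ''y'' 0 = nums s ''q'' 0"
    using t(2,3) unfolding I_def lift_frame_def by auto
  ultimately show ?thesis
    using t(2) unfolding I_def L_def by auto
qed

text \<open>However long the loop runs, \<open>lift_frame\<close> keeps registers and operation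
  counters fixed. The invariant traps the ranks: they stay below Even's measure on \<open>Y\<close>,
  and on exit all classes below the top are lifted.\<close>

lemma lift_prog_total:
  fixes s :: "'v state"
  assumes G: "game_graph G" and c: "\<And>v. v \<in> verts G \<Longrightarrow> prio G v < c" and b: "b = Suc (card (verts G))"
    and s: "refine_inv G c s"
    and st: "stable_edges G (nums s ''q'' 0) (\<lambda>a. regs s (''B'', a)) (edge_rel G s)"
  shows "\<exists>t. exec G lift_prog s t \<and> lift_frame s t \<and>
    winning_set G Even = (\<Union>a\<in>{a. a < nums s ''q'' 0 \<and> nums t ''r'' a < b ^ c}. regs s (''B'', a)) \<and>
    winning_set G Odd = (\<Union>a\<in>{a. a < nums s ''q'' 0 \<and> \<not> nums t ''r'' a < b ^ c}. regs s (''B'', a))"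
proof -
  obtain Y \<rho> \<rho>' where Y: "Y \<subseteq> verts G" and pm: "progress_measure G Even b \<rho> Y"
    and \<rho>: "\<And>v. v \<in> Y \<Longrightarrow> \<rho> v < b ^ c" and pm': "progress_measure G Odd b \<rho>' (verts G - Y)"
    using small_progress_measures[OF G c b, of Even] by (metis opponent.simps(1))
  let ?q = "nums s ''q'' 0" and ?B = "\<lambda>a. regs s (''B'', a)"
  let ?d = "nums s ''d''" and ?e = "nums s ''e''" and ?w = "nums s ''o''"
  have cl: "classes G b (verts G) ?q ?B ?d ?e ?w" and n: "nums s ''n'' 0 = card (verts G)"
    and w: "nums s ''w'' 0 = b ^ c" and r0: "nums s ''r'' = (\<lambda>_. 0)" and x0: "nums s ''x'' 0 = 0"
    using s unfolding refine_inv_def state_classes_def base_inv_def b by auto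
  have bpos: "b > 0" using b by simp
  have dpos: "?d a > 0" if "a < ?q" for a
  proof -
    have "?B a \<noteq> {}" "class_attrs G b (?B a) (?d a) (?e a) (?w a)"
      using cl that unfolding classes_def by blast+
    then show ?thesis using bpos unfolding class_attrs_def by force
  qed
  define settled where "settled r a \<longleftrightarrow> (r a < b ^ c \<longrightarrow> lifted ?q (edge_rel G s) ?e ?w r a)" for r a
  define I where "I t \<longleftrightarrow> lift_frame s t \<and> nums t ''x'' 0 \<le> ?q \<and>
      (\<forall>a<?q. ?d a dvd nums t ''r'' a) \<and>
      (\<forall>a<?q. \<forall>v \<in> ?B a \<inter> Y. nums t ''r'' a \<le> \<rho> v) \<and>
      (\<forall>a<nums t ''x'' 0. settled (nums t ''r'') a)" for t :: "'v state"
  \<comment> \<open>Lexicographic: a raised rank lowers the sum, and the weight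
    \<open>Suc ?q\<close> outweighs the return of \<open>x\<close> to 0.\<close>
  define \<mu> where "\<mu> t = (\<Sum>a<?q. b ^ c - nums t ''r'' a) * Suc ?q + (?q - nums t ''x'' 0)" for t :: "'v state"
  let ?body = "Seq check_init (Seq (While (Less (var ''y'') (var ''q'')) check_body) lift_step)"
  have init: "I s"
    unfolding I_def lift_frame_def using r0 x0 by simp
  have "\<exists>t. exec G (While (Less (var ''x'') (var ''q'')) ?body) s t \<and> I t \<and>
      \<not> bval (Less (var ''x'') (var ''q'')) (nums t)"
  proof (rule exec_While_total[where I = I and \<mu> = \<mu>, OF _ init])
    fix t :: "'v state"
    assume inv: "I t" and bv: "bval (Less (var ''x'') (var ''q'')) (nums t)"
    let ?x = "nums t ''x'' 0" and ?r = "nums t ''r''"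
    have ft: "lift_frame s t" using inv unfolding I_def by blast
    have x: "?x < ?q"
      using ft bv unfolding lift_frame_def by simp
    have edge: "edge_rel G t = edge_rel G s"
      using ft unfolding lift_frame_def edge_rel_def fun_eq_iff by simp
    have "nums t ''n'' 0 = card (verts G)"
      using ft n unfolding lift_frame_def by simp
    from check_total[OF this] obtain u
      where u: "exec G (Seq check_init (While (Less (var ''y'') (var ''q'')) check_body)) t u"
      and ftu: "lift_frame t u" and xu: "nums u ''x'' = nums t ''x''" and ru: "nums u ''r'' = ?r"
      and gu: "nums u ''g'' 0 = of_bool (lifted (nums t ''q'' 0) (edge_rel G t) (nums t ''e'')
        (nums t ''o'') ?r ?x)"
      by blast
    have gu': "nums u ''g'' 0 = of_bool (lifted ?q (edge_rel G s) ?e ?w ?r ?x)"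
      using gu edge ft unfolding lift_frame_def by simp
    have fsu: "lift_frame s u" by (rule lift_frame_trans[OF ft ftu])
    let ?t = "run G lift_step u"
    \<comment> \<open>Only a reassociation of \<open>Seq\<close>: the check was treated together
      with its initialisation.\<close>
    have exec: "exec G ?body t ?t"
    proof -
      obtain u' where "exec G check_init t u'" "exec G (While (Less (var ''y'') (var ''q'')) check_body) u' u"
        using u by (auto elim: exec.cases)
      moreover have "exec G lift_step u ?t"
        by (rule exec_run) (simp add: lift_step_def)
      ultimately show ?thesis by (blast intro: exec.Seq)
    qed
    have wu: "nums u ''w'' 0 = b ^ c" and du: "nums u ''d'' = ?d"
      using fsu w unfolding lift_frame_def by auto
    have ftt: "lift_frame s ?t"
      using fsu unfolding lift_frame_def lift_step_def by (simp add: step_simps)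
    have "I ?t \<and> \<mu> ?t < \<mu> t"
    proof (cases "settled ?r ?x")
      case True
      then have rt: "nums ?t ''r'' = ?r" and xt: "nums ?t ''x'' 0 = Suc ?x"
        unfolding lift_step_def settled_def using gu' wu ru xu by (auto simp: step_simps)
      show ?thesis
        using inv True x ftt unfolding I_def \<mu>_def rt xt by (auto simp: less_Suc_eq)
    next
      case False
      then have nl: "\<not> lifted ?q (edge_rel G s) ?e ?w ?r ?x" and lt: "?r ?x < b ^ c"
        unfolding settled_def by auto
      have rt: "nums ?t ''r'' = ?r(?x := ?r ?x + ?d ?x)" and xt: "nums ?t ''x'' 0 = 0"
        unfolding lift_step_def using gu' wu ru xu du nl lt by (simp_all add: step_simps)
      have "?r ?x + ?d ?x \<le> \<rho> v" if "v \<in> ?B ?x \<inter> Y" for v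
        using inv x nl that unfolding I_def
        by (intro lift_below_measure[OF G bpos cl st pm Y]) auto
      then have "I ?t"
        using inv ftt unfolding I_def rt xt by (simp add: all_conj_distrib)
      moreover have "\<mu> ?t < \<mu> t"
      proof -
        have "(\<Sum>a<?q. b ^ c - (?r(?x := ?r ?x + ?d ?x)) a) < (\<Sum>a<?q. b ^ c - ?r a)"
          using x lt dpos[OF x] by (intro sum_strict_mono_ex1) auto
        then have "Suc (\<Sum>a<?q. b ^ c - (?r(?x := ?r ?x + ?d ?x)) a) * Suc ?q \<le>
            (\<Sum>a<?q. b ^ c - ?r a) * Suc ?q"
          by (intro mult_le_mono1) simp
        then show ?thesis
          unfolding \<mu>_def rt xt by simp
      qed
      ultimately show ?thesis by blast
    qed
    then show "\<exists>t'. exec G ?body t t' \<and> I t' \<and> \<mu> t' < \<mu> t"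
      using exec by blast
  qed
  then obtain t where t: "exec G lift_prog s t" "I t" "\<not> nums t ''x'' 0 < nums t ''q'' 0"
    unfolding lift_prog_def by auto
  have x: "nums t ''x'' 0 = ?q"
    using t(2,3) unfolding I_def lift_frame_def by auto
  have "winning_set G Even = (\<Union>a\<in>{a. a < ?q \<and> nums t ''r'' a < b ^ c}. ?B a) \<and>
    winning_set G Odd = (\<Union>a\<in>{a. a < ?q \<and> \<not> nums t ''r'' a < b ^ c}. ?B a)"
    using t(2) x unfolding I_def settled_def
    by (intro conjI lifted_winning_sets[OF G bpos c cl st _ _ _ \<rho> pm']) auto
  then show ?thesis
    using t(1,2) unfolding I_def by blast
qed

section \<open>Collecting the winning classes\<close>

lemma output_prog_total:
  assumes q: "nums s ''q'' 0 \<le> n" and z: "nums s ''z'' 0 = 0"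
    and W: "regs s (''WE'', 0) = {}" "regs s (''WO'', 0) = {}" and U: "used s \<subseteq> regs_bound n c"
  shows "\<exists>t. exec G output_prog s t \<and>
    regs t (''WE'', 0) =
      (\<Union>a\<in>{a. a < nums s ''q'' 0 \<and> nums s ''r'' a < nums s ''w'' 0}. regs s (''B'', a)) \<and>
    regs t (''WO'', 0) =
      (\<Union>a\<in>{a. a < nums s ''q'' 0 \<and> \<not> nums s ''r'' a < nums s ''w'' 0}. regs s (''B'', a)) \<and>
    one_steps t = one_steps s \<and> set_ops t \<le> set_ops s + n \<and> used t \<subseteq> regs_bound n c"
proof -
  let ?q = "nums s ''q'' 0" and ?r = "nums s ''r''" and ?w = "nums s ''w'' 0"
  define I where "I t \<longleftrightarrow> nums t ''q'' = nums s ''q'' \<and> nums t ''r'' = ?r \<and> nums t ''w'' = nums s ''w'' \<and>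
      nums t ''z'' 0 \<le> ?q \<and> (\<forall>a. regs t (''B'', a) = regs s (''B'', a)) \<and>
      regs t (''WE'', 0) = (\<Union>a\<in>{a. a < nums t ''z'' 0 \<and> ?r a < ?w}. regs s (''B'', a)) \<and>
      regs t (''WO'', 0) = (\<Union>a\<in>{a. a < nums t ''z'' 0 \<and> \<not> ?r a < ?w}. regs s (''B'', a)) \<and>
      one_steps t = one_steps s \<and> set_ops t = set_ops s + nums t ''z'' 0 \<and>
      used t \<subseteq> regs_bound n c" for t :: "'a state"
  have init: "I s" unfolding I_def using z W U by simp
  have "\<exists>t. exec G (While (Less (var ''z'') (var ''q'')) output_body) s t \<and> I t \<and>
      \<not> bval (Less (var ''z'') (var ''q'')) (nums t)"
  proof (rule exec_While_total[where I = I and \<mu> = "\<lambda>t. ?q - nums t ''z'' 0", OF _ init])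
    fix t :: "'a state"
    assume inv: "I t" and b: "bval (Less (var ''z'') (var ''q'')) (nums t)"
    let ?z = "nums t ''z'' 0"
    have z: "?z < ?q" using inv b unfolding I_def by simp
    have "{a. a < Suc ?z \<and> P a} = (if P ?z then {a. a < ?z \<and> P a} \<union> {?z} else {a. a < ?z \<and> P a})" for P
      by (auto simp: less_Suc_eq)
    note ins = this[of "\<lambda>a. ?r a < ?w"] this[of "\<lambda>a. \<not> ?r a < ?w"]
    have "I (run G output_body t) \<and> nums (run G output_body t) ''z'' 0 = Suc ?z"
      using inv z q unfolding I_def output_body_def by (simp add: step_simps ins Un_commute)
    moreover have "loop_free output_body" unfolding output_body_def by simp
    ultimately show "\<exists>t'. exec G output_body t t' \<and> I t' \<and> ?q - nums t' ''z'' 0 < ?q - ?z"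
      using exec_run[of output_body G t] z by (intro exI[of _ "run G output_body t"]) auto
  qed
  then obtain t where t: "exec G output_prog s t" "I t" "\<not> nums t ''z'' 0 < nums t ''q'' 0"
    unfolding output_prog_def by auto
  then have "nums t ''z'' 0 = ?q" unfolding I_def by auto
  then show ?thesis
    using t q unfolding I_def by auto
qed

section \<open>Operation counts\<close>

lemma parity_game_card_ge:
  assumes "parity_game G c"
  shows "c \<le> card (verts G) + 1"
proof -
  have fin: "finite (verts G)"
    using assms unfolding parity_game_def game_graph_def by simp
  have "{1..<c} \<subseteq> prio G ` verts G"
  proof
    fix i assume "i \<in> {1..<c}"
    then have "prio_class G i \<noteq> {}"
      using assms unfolding parity_game_def by auto
    then show "i \<in> prio G ` verts G"
      unfolding prio_class_def by auto
  qed
  then have "card {1..<c} \<le> card (prio G ` verts G)"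
    using fin by (intro card_mono) auto
  also have "\<dots> \<le> card (verts G)"
    using fin by (rule card_image_le)
  finally show ?thesis by simp
qed

text \<open>With \<open>k = c div 2\<close>, Bernoulli at \<open>n / k - 1\<close> gives
  \<open>(n / k) ^ k \<ge> n - k + 1\<close>, and \<open>2 * k \<le> c \<le> n + 1\<close> makes
  this at least \<open>n / 2\<close>.\<close>

lemma xi_ge_half:
  assumes "c \<ge> 2" "c \<le> n + 1"
  shows "real n / 2 \<le> xi n c"
proof -
  let ?k = "c div 2"
  have k: "?k \<ge> 1" "2 * ?k \<le> n + 1" using assms by auto
  let ?x = "real n / real ?k - 1"
  have "real n / real ?k \<ge> 0" by simp
  then have "1 + real ?k * ?x \<le> (1 + ?x) ^ ?k"
    by (intro Bernoulli_inequality) simp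
  moreover have "real ?k * ?x = real n - real ?k"
    using k by (simp add: field_simps)
  moreover have "2 * real ?k \<le> real n + 1"
    using k(2) by linarith
  ultimately show ?thesis unfolding xi_def by simp
qed

lemma parity_prog_total:
  assumes pg: "parity_game G c" and n: "n = card (verts G)"
  shows "\<exists>t. exec G parity_prog (initial_state G c) t \<and>
    regs t (''WE'', 0) = winning_set G Even \<and> regs t (''WO'', 0) = winning_set G Odd \<and>
    one_steps t \<le> n * (n + 2) + n + 1 \<and>
    set_ops t \<le> 4 * c + 5 * (n * (n + 2) ^ 2 + n * (n + 2) + n) + n \<and>
    used t \<subseteq> regs_bound n c"
proof -
  have G: "game_graph G" and c: "\<And>v. v \<in> verts G \<Longrightarrow> prio G v < c"
    using pg unfolding parity_game_def by auto
  obtain s1 where e1: "exec G init_prog (initial_state G c) s1" and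
    s1: "base_inv G c s1" "state_classes G (verts G) s1" "nums s1 ''w'' 0 = Suc (card (verts G)) ^ c"
      "nums s1 ''a'' 0 = 0" "nums s1 ''b'' 0 = 0" "one_steps s1 = 0" "set_ops s1 = 4 * c"
    using init_prog_total[OF G c] by blast
  obtain s2 where e2: "exec G refine_prog s1 s2" and s2: "refine_inv G c s2"
    "stable_edges G (nums s2 ''q'' 0) (\<lambda>a. regs s2 (''B'', a)) (edge_rel G s2)"
    using refine_prog_total[OF G s1] by blast
  obtain s3 where e3: "exec G lift_prog s2 s3" and f: "lift_frame s2 s3" and W:
    "winning_set G Even = (\<Union>a\<in>{a. a < nums s2 ''q'' 0 \<and> nums s3 ''r'' a < Suc n ^ c}. regs s2 (''B'', a))"
    "winning_set G Odd = (\<Union>a\<in>{a. a < nums s2 ''q'' 0 \<and> \<not> nums s3 ''r'' a < Suc n ^ c}. regs s2 (''B'', a))"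
    using lift_prog_total[OF G c refl s2] unfolding n by blast
  have f': "regs s3 = regs s2" "one_steps s3 = one_steps s2" "set_ops s3 = set_ops s2"
      "used s3 = used s2" "nums s3 ''q'' = nums s2 ''q''" "nums s3 ''w'' = nums s2 ''w''"
      "nums s3 ''z'' = nums s2 ''z''"
    using f unfolding lift_frame_def by auto
  have q: "nums s2 ''q'' 0 \<le> n" and b: "nums s2 ''b'' 0 \<le> nums s2 ''q'' 0"
    and a: "nums s2 ''a'' 0 \<le> nums s2 ''q'' 0" and w: "nums s2 ''w'' 0 = Suc n ^ c"
    and base: "base_inv G c s2"
    and one: "one_steps s2 \<le> nums s2 ''q'' 0 * (n + 2) + nums s2 ''b'' 0 + 1"
    and set_ops: "set_ops s2 \<le> 4 * c + 5 * refine_pos G s2"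
    using s2(1) state_classes_card_le[OF G] unfolding refine_inv_def n by auto
  obtain t where e4: "exec G output_prog s3 t" and t:
    "regs t (''WE'', 0) = winning_set G Even" "regs t (''WO'', 0) = winning_set G Odd"
    "one_steps t = one_steps s2" "set_ops t \<le> set_ops s2 + n" "used t \<subseteq> regs_bound n c"
    using output_prog_total[of s3 n c G] q base unfolding base_inv_def W f' w n by auto
  have "nums s2 ''q'' 0 * (n + 2) \<le> n * (n + 2)"
    using q by (rule mult_le_mono1)
  then have "one_steps t \<le> n * (n + 2) + n + 1"
    using one t(3) q b by linarith
  moreover have "refine_pos G s2 \<le> n * (n + 2) ^ 2 + n * (n + 2) + n"
    unfolding refine_pos_def n[symmetric] using q a b by (intro add_mono mult_le_mono) auto
  moreover have "exec G parity_prog (initial_state G c) t"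
    unfolding parity_prog_def by (rule exec.Seq[OF e1 exec.Seq[OF e2 exec.Seq[OF e3 e4]]])
  ultimately show ?thesis
    using t set_ops by (intro exI[of _ t]) auto
qed

theorem theorem8:
  shows "\<exists>(prog :: com) (K1 :: real) (K2 :: real) (K3 :: real).
    \<forall>(G :: 'v game) (c :: nat) (n :: nat).
      c \<ge> 2 \<and> parity_game G c \<and> n = card (verts G) \<longrightarrow>
      (\<exists>t. exec G prog (initial_state G c) t \<and>
           regs t (''WE'', 0) = winning_set G Even \<and>
           regs t (''WO'', 0) = winning_set G Odd \<and>
           real (one_steps t) \<le> K1 * (real c * real n * xi n c) \<and>
           real (set_ops t) \<le> K2 * (real c * real n ^ 2 * xi n c) \<and>
           real (card (used t)) \<le> K3 * real n)"
proof (rule exI[of _ parity_prog], rule exI[of _ 5], rule exI[of _ 74], rule exI[of _ 11],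
    intro allI impI, elim conjE)
  fix G :: "'v game" and c n :: nat
  assume c2: "c \<ge> 2" and pg: "parity_game G c" and n: "n = card (verts G)"
  obtain t where t: "exec G parity_prog (initial_state G c) t"
    "regs t (''WE'', 0) = winning_set G Even" "regs t (''WO'', 0) = winning_set G Odd"
    "one_steps t \<le> n * (n + 2) + n + 1"
    "set_ops t \<le> 4 * c + 5 * (n * (n + 2) ^ 2 + n * (n + 2) + n) + n"
    "used t \<subseteq> regs_bound n c"
    using parity_prog_total[OF pg n] by blast
  have cn: "c \<le> n + 1" using parity_game_card_ge[OF pg] n by simp
  have n1: "1 \<le> n" using c2 cn by simp
  then have pow: "n \<le> n ^ 2" "n ^ 2 \<le> n ^ 3" "1 \<le> n ^ 2"
    by (simp_all add: power2_eq_square power3_eq_cube)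
  \<comment> \<open>Since \<open>c \<ge> 2\<close>, one factor \<open>n\<close> is paid for by
    \<open>c * xi n c\<close>; it remains to bound the counts by \<open>n ^ 2\<close> and
    \<open>n ^ 3\<close>.\<close>
  have xi: "real n \<le> real c * xi n c"
    using mult_mono[of 2 "real c" "real n / 2" "xi n c"] xi_ge_half[OF c2 cn] c2 by simp
  have "one_steps t \<le> n ^ 2 + 3 * n + 1"
    using t(4) by (simp add: power2_eq_square)
  \<comment> \<open>5 is the coefficient sum 1 + 3 + 1, as \<open>n \<ge> 1\<close>.\<close>
  then have "one_steps t \<le> 5 * n ^ 2"
    using pow by linarith
  then have "real (one_steps t) \<le> 5 * (real n * real n)"
    by (metis of_nat_le_iff of_nat_mult of_nat_numeral power2_eq_square)
  also have "\<dots> \<le> 5 * (real c * real n * xi n c)"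
    using mult_left_mono[OF xi, of "real n"] by (simp add: mult_ac)
  finally have one: "real (one_steps t) \<le> 5 * (real c * real n * xi n c)" .
  have "set_ops t \<le> 4 * c + 5 * n ^ 3 + 25 * n ^ 2 + 36 * n"
    using t(5) by (simp add: power2_eq_square power3_eq_cube algebra_simps)
  \<comment> \<open>74 = 5 + 25 + 36 + 8, where 8 stems from
    \<open>4 * c \<le> 4 * n + 4\<close>.\<close>
  also have "\<dots> \<le> 74 * n ^ 3"
    using pow cn n1 by linarith
  finally have "real (set_ops t) \<le> 74 * (real n ^ 2 * real n)"
    by (metis of_nat_le_iff of_nat_mult of_nat_numeral of_nat_power power2_eq_square power3_eq_cube)
  also have "\<dots> \<le> 74 * (real c * real n ^ 2 * xi n c)"
    using mult_left_mono[OF xi, of "real n ^ 2"] by (simp add: mult_ac)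
  finally have two: "real (set_ops t) \<le> 74 * (real c * real n ^ 2 * xi n c)" .
  have "finite (regs_bound n c)"
    unfolding regs_bound_def input_regs_def by simp
  then have "card (used t) \<le> n + c + 8"
    using card_mono[OF _ t(6)] card_regs_bound[of n c] by simp
  \<comment> \<open>With \<open>c \<le> n + 1\<close> there are at most \<open>2 * n + 9\<close>
    registers, and \<open>n \<ge> 1\<close>.\<close>
  then have "real (card (used t)) \<le> 11 * real n"
    using cn n1 by linarith
  then show "\<exists>t. exec G parity_prog (initial_state G c) t \<and>
      regs t (''WE'', 0) = winning_set G Even \<and>
      regs t (''WO'', 0) = winning_set G Odd \<and>
      real (one_steps t) \<le> 5 * (real c * real n * xi n c) \<and>
      real (set_ops t) \<le> 74 * (real c * real n ^ 2 * xi n c) \<and>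
      real (card (used t)) \<le> 11 * real n"
    using t one two by blast
qed

end
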